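(* Let $d\ge 1$ be an integer. For a typical continuous function $f\colon[0,1]^d\to\mathbb{R}$, each of the two sets $$\{x\in[0,1]^d:\operatorname{lip} f(x)>0\},\qquad \{x\in[0,1]^d:\operatorname{lip} f(x)=\infty\}$$ is $\sigma$-strongly porous in $\mathbb{R}^d$, and for each of them both the lower packing dimension $\underline{\dim}_{\mathsf P}$ and the Hausdorff dimension $\dim_{\mathsf H}$ are equal to $d-1$.
   Context: "For a typical $f$ ... holds" means: there is a comeager set $\mathcal{F}\subseteq C([0,1]^d)$ (sup norm) such that every $f\in\mathcal{F}$ has the property. $B(x,r)$ is the closed ball of radius $r$ about $x$ in the domain of $f$. Little lip function: $\operatorname{lip} f(x)=\liminf_{r\to0+}\frac{\operatorname{diam} f(B(x,r))}{r}\in[0,\infty]$. Strong porosity: for a subset $E$ of a metric space $X$, $x\in E$, $r>0$, let $\gamma(E,x,r)=\sup\{s:\exists y\in B(x,r)\ B(y,s)\cap E=\emptyset\}$ (with $\sup\emptyset=0$; balls in $X$) and $\mathsf{por}(E,x)=\limsup_{r\to0}\gamma(E,x,r)/r$. $E$ is strongly porous if $\mathsf{por}(E,x)=1$ for every $x\in E$; $E$ is $\sigma$-strongly porous if it is a countable union of strongly porous sets. Lower packing dimension: for $\delta>0$ let $N_\delta(E)$ be the least number of sets of diameter at most $\delta$ needed to cover $E$. For $s>0$ let $\boldsymbol{\nu}^s_0(E)=\liminf_{\delta\to0}N_\delta(E)\delta^s$ and $\boldsymbol{\nu}^s(E)=\inf\{\sum_n\boldsymbol{\nu}^s_0(E_n):\{E_n\}\text{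 a countable cover of }E\}$. Then $\underline{\dim}_{\mathsf P}E=\sup\{s>0:\boldsymbol{\nu}^s(E)>0\}$ ($\sup\emptyset=0$). Hausdorff dimension is the usual one. *)

theory Defs
  imports "HOL-Analysis.Analysis"
begin

definition nowhere_dense_in :: "'a topology \<Rightarrow> 'a set \<Rightarrow> bool" where
  "nowhere_dense_in X N \<longleftrightarrow> N \<subseteq> topspace X \<and> X interior_of (X closure_of N) = {}"

definition meager_in :: "'a topology \<Rightarrow> 'a set \<Rightarrow> bool" where
  "meager_in X M \<longleftrightarrow> (\<exists>\<N>. countable \<N> \<and> (\<forall>N\<in>\<N>. nowhere_dense_in X N) \<and> M = \<Union>\<N>)"

definition comeager_in :: "'a topology \<Rightarrow> 'a set \<Rightarrow> bool" where
  "comeager_in X F \<longleftrightarrow> F \<subseteq> topspace X \<and> meager_in X (topspace X - F)"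

(* The elements are the continuous maps on the cube extended by undefined outside it;
   the distance is the supremum of the pointwise distances over the cube. *)
abbreviation cube_cfunspace :: "(real ^ 'n \<Rightarrow> real) metric" where
  "cube_cfunspace \<equiv> cfunspace (top_of_set (cbox 0 1)) euclidean_metric"

(* S is the domain of f. The library diameter is real-valued and only meaningful on bounded
   sets, so this is intended for f that is bounded on S. *)
definition little_lip :: "'a::metric_space set \<Rightarrow> ('a \<Rightarrow> 'b::metric_space) \<Rightarrow> 'a \<Rightarrow> ennreal" where
  "little_lip S f x = Liminf (at_right 0) (\<lambda>r. ennreal (diameter (f ` (S \<inter> cball x r)) / r))"

(* The supremum of the empty set is 0 in ennreal, as the convention requires. *)
definition porosity_radius :: "'a::metric_space set \<Rightarrow> 'a \<Rightarrow> real \<Rightarrow> ennreal" where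
  "porosity_radius E x r =
     Sup {ennreal s | s. s > 0 \<and> (\<exists>y\<in>cball x r. cball y s \<inter> E = {})}"

definition porosity :: "'a::metric_space set \<Rightarrow> 'a \<Rightarrow> ennreal" where
  "porosity E x = Limsup (at_right 0) (\<lambda>r. porosity_radius E x r / ennreal r)"

definition strongly_porous :: "'a::metric_space set \<Rightarrow> bool" where
  "strongly_porous E \<longleftrightarrow> (\<forall>x\<in>E. porosity E x = 1)"

definition sigma_strongly_porous :: "'a::metric_space set \<Rightarrow> bool" where
  "sigma_strongly_porous E \<longleftrightarrow>
     (\<exists>\<P>. countable \<P> \<and> (\<forall>P\<in>\<P>. strongly_porous P) \<and> E = \<Union>\<P>)"

(* Infinite if there is no finite cover. Boundedness is required explicitly here and below
   because the library diameter of an unbounded set is unspecified. *)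
definition covering_number :: "real \<Rightarrow> 'a::metric_space set \<Rightarrow> ennreal" where
  "covering_number \<delta> E =
     Inf {of_nat (card \<U>) | \<U>. finite \<U> \<and> E \<subseteq> \<Union>\<U> \<and> (\<forall>U\<in>\<U>. bounded U \<and> diameter U \<le> \<delta>)}"

definition lower_packing_premeasure :: "real \<Rightarrow> 'a::metric_space set \<Rightarrow> ennreal" where
  "lower_packing_premeasure s E =
     Liminf (at_right 0) (\<lambda>\<delta>. covering_number \<delta> E * ennreal (\<delta> powr s))"

definition lower_packing_measure :: "real \<Rightarrow> 'a::metric_space set \<Rightarrow> ennreal" where
  "lower_packing_measure s E =
     Inf {(\<Sum>n. lower_packing_premeasure s (A n)) | A. E \<subseteq> (\<Union>n::nat. A n)}"

definition lower_packing_dim :: "'a::metric_space set \<Rightarrow> ennreal" where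
  "lower_packing_dim E = Sup {ennreal s | s. s > 0 \<and> lower_packing_measure s E > 0}"

definition hausdorff_premeasure :: "real \<Rightarrow> real \<Rightarrow> 'a::metric_space set \<Rightarrow> ennreal" where
  "hausdorff_premeasure s \<delta> E =
     Inf {(\<Sum>n. ennreal (diameter (A n) powr s)) | A.
            E \<subseteq> (\<Union>n::nat. A n) \<and> (\<forall>n. bounded (A n) \<and> diameter (A n) \<le> \<delta>)}"

definition hausdorff_measure :: "real \<Rightarrow> 'a::metric_space set \<Rightarrow> ennreal" where
  "hausdorff_measure s E = (SUP \<delta>\<in>{0<..}. hausdorff_premeasure s \<delta> E)"

(* Only s > 0 is used, so the value of 0 powr 0 is irrelevant; the empty set has dimension 0. *)
definition hausdorff_dim :: "'a::metric_space set \<Rightarrow> ennreal" where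
  "hausdorff_dim E = Sup {ennreal s | s. s > 0 \<and> hausdorff_measure s E > 0}"

end

(*
  Lower bound. For a typical f and every n there is a window length h < 1/n such that on each line
  parallel to a fixed axis f oscillates by more than n h in every window of length h (perturb f by a
  fast cosine). On each such line, alternately bisecting a steep interval and jumping into a
  steeper window produces a point where lip f is infinite. The set of these points therefore
  projects onto a facet of the cube, so its (d-1)-dimensional Hausdorff measure is positive.

  Upper bound. A typical f is, for every n, almost constant at some small scale off a thin set Z_n,
  so {lip f > 0} is contained in the union over N of the intersections of the Z_n with n >= N. Density of
  this property: replace f by a sum of small steps, the k-th step being a function of the distance
  to the points of a finite net where f is at most the k-th level, and located at distance about
  rho_k. With rho_k increasing, Z_n is a union of thin spherical shells having nearly maximal holes
  at a scale much larger than their width, and about delta^(1-d) sets of diameter delta cover it.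

  The Hausdorff dimension is at most the lower packing dimension, so these two bounds suffice.
*)
theory Submission
  imports Defs
begin

section \<open>Dimensions and porosity\<close>

lemma covering_number_mono:
  assumes "E \<subseteq> F"
  shows "covering_number \<delta> E \<le> covering_number \<delta> F"
  unfolding covering_number_def using assms by (intro Inf_superset_mono) auto

lemma hausdorff_premeasure_le_suminf:
  assumes "E \<subseteq> (\<Union>n. A n)" "\<And>n. bounded (A n)" "\<And>n. diameter (A n) \<le> \<delta>"
  shows "hausdorff_premeasure s \<delta> E \<le> (\<Sum>n. ennreal (diameter (A n) powr s))"
  unfolding hausdorff_premeasure_def by (rule Inf_lower) (use assms in blast)

text \<open>Almost optimal covers of the sets \<open>B n\<close>, with errors summing to
  \<open>e\<close>, are merged into one sequence through \<open>prod_decode\<close>.\<close>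

lemma hausdorff_premeasure_countable_subadditive:
  fixes B :: "nat \<Rightarrow> 'a::metric_space set"
  assumes "E \<subseteq> (\<Union>n. B n)"
  shows "hausdorff_premeasure s \<delta> E \<le> (\<Sum>n. hausdorff_premeasure s \<delta> (B n))"
proof (cases "(\<Sum>n. hausdorff_premeasure s \<delta> (B n)) = top")
  case False
  show ?thesis
  proof (rule ennreal_le_epsilon)
    fix e :: real assume e: "e > 0"
    have "\<exists>A. B n \<subseteq> (\<Union>k::nat. A k) \<and> (\<forall>k. bounded (A k) \<and> diameter (A k) \<le> \<delta>) \<and>
        (\<Sum>k. ennreal (diameter (A k) powr s))
          \<le> hausdorff_premeasure s \<delta> (B n) + ennreal (e * (1/2)^Suc n)" for n
    proof -
      \<comment> \<open>Finiteness makes the added error a strict increase, so some cover of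
        \<open>B n\<close> undercuts it.\<close>
      have "hausdorff_premeasure s \<delta> (B n) \<noteq> top"
        using False ennreal_suminf_lessD less_top by metis
      then have "hausdorff_premeasure s \<delta> (B n)
          < hausdorff_premeasure s \<delta> (B n) + ennreal (e * (1/2)^Suc n)"
        using e by (simp add: ennreal_add_left_cancel_less[of _ 0, simplified] less_top)
      then show ?thesis
        unfolding hausdorff_premeasure_def[of s \<delta> "B n"] Inf_less_iff by (auto intro: less_imp_le)
    qed
    then obtain A where A: "\<And>n. B n \<subseteq> (\<Union>k::nat. A n k)"
      "\<And>n k. bounded (A n k)" "\<And>n k. diameter (A n k) \<le> \<delta>"
      "\<And>n. (\<Sum>k. ennreal (diameter (A n k) powr s))
          \<le> hausdorff_premeasure s \<delta> (B n) + ennreal (e * (1/2)^Suc n)"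
      by metis
    define C where "C = (\<lambda>i. case prod_decode i of (n, k) \<Rightarrow> A n k)"
    have "E \<subseteq> (\<Union>i. C i)"
    proof
      fix x assume "x \<in> E"
      then obtain n k where "x \<in> A n k" using assms A(1) by blast
      then have "x \<in> C (prod_encode (n, k))" by (simp add: C_def)
      then show "x \<in> (\<Union>i. C i)" by blast
    qed
    then have "hausdorff_premeasure s \<delta> E \<le> (\<Sum>i. ennreal (diameter (C i) powr s))"
      by (rule hausdorff_premeasure_le_suminf) (auto simp: C_def A split: prod.split)
    also have "\<dots> = (\<Sum>i. (\<lambda>(n, k). ennreal (diameter (A n k) powr s)) (prod_decode i))"
      by (intro suminf_cong) (simp add: C_def split: prod.split)
    also have "\<dots> = (\<Sum>n. \<Sum>k. ennreal (diameter (A n k) powr s))"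
      by (rule suminf_ennreal_2dimen) simp
    also have "\<dots> \<le> (\<Sum>n. hausdorff_premeasure s \<delta> (B n) + ennreal (e * (1/2)^Suc n))"
      by (intro suminf_le A(4)) auto
    also have "\<dots> = (\<Sum>n. hausdorff_premeasure s \<delta> (B n)) + (\<Sum>n. ennreal (e * (1/2)^Suc n))"
      by (rule suminf_add[symmetric]) auto
    also have "(\<Sum>n. ennreal (e * (1/2)^Suc n)) = ennreal e"
      using e sums_mult[OF power_half_series, of e]
      by (intro suminf_ennreal_eq) auto
    finally show "hausdorff_premeasure s \<delta> E
        \<le> (\<Sum>n. hausdorff_premeasure s \<delta> (B n)) + ennreal e" .
  qed
qed auto

text \<open>Finitely many sets of diameter at most \<open>\<epsilon>\<close>, padded with empty
  sets, form an admissible sequence; each of them contributes at most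
  \<open>\<epsilon> powr s\<close> and the padding contributes 0.\<close>

lemma hausdorff_premeasure_le_covering_number:
  assumes "0 < \<epsilon>" "\<epsilon> \<le> \<delta>" "s > 0"
  shows "hausdorff_premeasure s \<delta> E \<le> covering_number \<epsilon> E * ennreal (\<epsilon> powr s)"
proof -
  \<comment> \<open>Dividing isolates \<open>card U\<close>, so the infimum over covers can be taken
    before the factor is restored.\<close>
  have *: "hausdorff_premeasure s \<delta> E / ennreal (\<epsilon> powr s) \<le> of_nat (card U)"
    if "finite U" "E \<subseteq> \<Union>U" "\<forall>A\<in>U. bounded A \<and> diameter A \<le> \<epsilon>" for U
  proof -
    obtain f where f: "bij_betw f {..<card U} U"
      using ex_bij_betw_nat_finite[OF \<open>finite U\<close>] by (auto simp: atLeast0LessThan)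
    define A where "A = (\<lambda>n. if n < card U then f n else {})"
    have A: "bounded (A n)" "diameter (A n) \<le> \<epsilon>" for n
      using that(3) bij_betwE[OF f] \<open>0 < \<epsilon>\<close> by (auto simp: A_def)
    have "E \<subseteq> (\<Union>n. A n)"
    proof
      fix x assume "x \<in> E"
      then obtain V where "V \<in> U" "x \<in> V" using \<open>E \<subseteq> \<Union>U\<close> by blast
      then obtain n where "n < card U" "f n = V"
        using f by (metis bij_betw_iff_bijections lessThan_iff)
      then show "x \<in> (\<Union>n. A n)" using \<open>x \<in> V\<close> by (auto simp: A_def)
    qed
    then have "hausdorff_premeasure s \<delta> E \<le> (\<Sum>n. ennreal (diameter (A n) powr s))"
      using A assms by (intro hausdorff_premeasure_le_suminf) (auto intro: order_trans)
    also have "\<dots> = (\<Sum>n<card U. ennreal (diameter (A n) powr s))"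
      using \<open>s > 0\<close> by (intro suminf_finite) (auto simp: A_def)
    also have "\<dots> \<le> (\<Sum>n<card U. ennreal (\<epsilon> powr s))"
      using A assms by (intro sum_mono ennreal_leI powr_mono2) (auto intro: diameter_ge_0)
    also have "\<dots> = of_nat (card U) * ennreal (\<epsilon> powr s)" by simp
    finally show ?thesis
      using assms by (intro divide_le_posI_ennreal) (auto simp: mult.commute)
  qed
  have "hausdorff_premeasure s \<delta> E / ennreal (\<epsilon> powr s) \<le> covering_number \<epsilon> E"
    unfolding covering_number_def by (intro Inf_greatest) (use * in blast)
  then have "hausdorff_premeasure s \<delta> E / ennreal (\<epsilon> powr s) * ennreal (\<epsilon> powr s)
      \<le> covering_number \<epsilon> E * ennreal (\<epsilon> powr s)"
    by (intro mult_right_mono) auto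
  then show ?thesis
    using assms by (simp add: ennreal_divide_times ennreal_times_divide ennreal_mult_divide_eq mult.commute)
qed

text \<open>Every scale \<open>\<epsilon> \<le> \<delta>\<close> yields covers admissible at
  \<open>\<delta>\<close>, so the comparison holds for the liminf on each piece; countable
  subadditivity sums over the pieces.\<close>

lemma hausdorff_measure_le_lower_packing_measure:
  assumes "s > 0"
  shows "hausdorff_measure s E \<le> lower_packing_measure s E"
proof -
  have *: "hausdorff_premeasure s \<delta> B \<le> lower_packing_premeasure s B" if "\<delta> > 0" for \<delta> and B :: "'a set"
    unfolding lower_packing_premeasure_def
  proof (rule Liminf_bounded)
    show "\<forall>\<^sub>F \<epsilon> in at_right 0. hausdorff_premeasure s \<delta> B \<le> covering_number \<epsilon> B * ennreal (\<epsilon> powr s)"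
      using eventually_at_right_real[OF \<open>\<delta> > 0\<close>]
      by eventually_elim (use assms in \<open>auto intro: hausdorff_premeasure_le_covering_number\<close>)
  qed
  show ?thesis
    unfolding hausdorff_measure_def lower_packing_measure_def
  proof (intro SUP_least Inf_greatest)
    fix \<delta> :: real and z
    assume "\<delta> \<in> {0<..}" and "z \<in> {(\<Sum>n. lower_packing_premeasure s (A n)) |A. E \<subseteq> (\<Union>n::nat. A n)}"
    then obtain A where A: "E \<subseteq> (\<Union>n::nat. A n)" "z = (\<Sum>n. lower_packing_premeasure s (A n))"
      by blast
    then have "hausdorff_premeasure s \<delta> E \<le> (\<Sum>n. hausdorff_premeasure s \<delta> (A n))"
      by (intro hausdorff_premeasure_countable_subadditive)
    also have "\<dots> \<le> (\<Sum>n. lower_packing_premeasure s (A n))"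
      using \<open>\<delta> \<in> {0<..}\<close> by (intro suminf_le *) auto
    finally show "hausdorff_premeasure s \<delta> E \<le> z" by (simp add: A)
  qed
qed

lemma hausdorff_dim_le_lower_packing_dim: "hausdorff_dim E \<le> lower_packing_dim E"
  unfolding hausdorff_dim_def lower_packing_dim_def
  by (intro Sup_subset_mono) (use hausdorff_measure_le_lower_packing_measure order_less_le_trans in blast)

section \<open>Criteria for strong porosity and for vanishing lower packing premeasure\<close>

lemma porosity_radius_le:
  assumes "x \<in> E"
  shows "porosity_radius E x r \<le> ennreal r"
  unfolding porosity_radius_def
proof (rule Sup_least, clarify)
  fix s y assume "s > 0" "y \<in> cball x r" "cball y s \<inter> E = {}"
  \<comment> \<open>The point \<open>x\<close> belongs to \<open>E\<close>, hence lies outside the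
    hole.\<close>
  then have "s < dist y x" "dist x y \<le> r" using assms by (auto simp: disjoint_iff not_le)
  then show "ennreal s \<le> ennreal r" by (intro ennreal_leI) (simp add: dist_commute)
qed

lemma porosity_radius_ge:
  assumes "s > 0" "y \<in> cball x r" "cball y s \<inter> E = {}"
  shows "ennreal s \<le> porosity_radius E x r"
  unfolding porosity_radius_def by (rule Sup_upper) (use assms in blast)

lemma porosity_le_1:
  assumes "x \<in> E"
  shows "porosity E x \<le> 1"
  unfolding porosity_def
proof (rule Limsup_bounded)
  show "\<forall>\<^sub>F r in at_right 0. porosity_radius E x r / ennreal r \<le> 1"
    using eventually_at_right_less[of "0::real"]
    by eventually_elim
      (use porosity_radius_le[OF assms] in \<open>auto intro!: divide_le_posI_ennreal\<close>)
qed

text \<open>A limsup needs only one radius below each \<open>e\<close>: holes of relative size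
  \<open>1 - e\<close> push it up to 1, and it never exceeds 1 at points of
  \<open>P\<close>.\<close>

lemma strongly_porousI:
  assumes holes: "\<And>x e. x \<in> P \<Longrightarrow> 0 < e \<Longrightarrow> e < 1 \<Longrightarrow>
      \<exists>t. 0 < t \<and> t < e \<and> (\<exists>y\<in>cball x t. cball y (t * (1 - e)) \<inter> P = {})"
  shows "strongly_porous P"
  unfolding strongly_porous_def
proof
  fix x assume x: "x \<in> P"
  have "\<not> porosity P x < 1"
  proof
    assume "porosity P x < 1"
    then obtain z where z: "porosity P x < z" "z < 1" using dense by blast
    then obtain c where c: "z = ennreal c" "0 \<le> c" "c < 1"
      by (cases z) (auto simp: top_unique)
    have "\<forall>\<^sub>F r in at_right 0. porosity_radius P x r / ennreal r < z"
      using z(1) unfolding porosity_def by (rule Limsup_lessD)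
    then obtain b where b: "b > 0" "\<And>r. 0 < r \<Longrightarrow> r < b \<Longrightarrow> porosity_radius P x r / ennreal r < z"
      by (auto simp: eventually_at_right_field)
    \<comment> \<open>This choice puts \<open>t\<close> below \<open>b\<close> and makes the hole
      radius at least \<open>c * t\<close>, against the assumed bound.\<close>
    define e where "e = min (1/2) (min b (1 - c))"
    have e: "0 < e" "e < 1" "e \<le> b" "c \<le> 1 - e" using b(1) c(3) by (auto simp: e_def)
    then obtain t y where t: "0 < t" "t < e" and y: "y \<in> cball x t" "cball y (t * (1 - e)) \<inter> P = {}"
      using holes[OF x, of e] by auto
    have r: "0 < t" "t < b" using t e by auto
    have "z * ennreal t = ennreal (c * t)" using c r by (simp add: ennreal_mult)
    also have "\<dots> \<le> ennreal (t * (1 - e))"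
      using e r by (intro ennreal_leI) (simp add: mult.commute)
    also have "\<dots> \<le> porosity_radius P x t"
      using t e y by (intro porosity_radius_ge) auto
    finally have "z * ennreal t / ennreal t \<le> porosity_radius P x t / ennreal t"
      by (rule divide_right_mono_ennreal)
    also have "\<dots> < z" using b(2)[OF r] .
    also have "z * ennreal t / ennreal t = z"
      using r(1) by (intro mult_divide_eq_ennreal) (simp_all add: ennreal_eq_0_iff not_le)
    finally show False by simp
  qed
  with porosity_le_1[OF x] show "porosity P x = 1" by (simp add: antisym not_less)
qed

text \<open>A liminf needs only one good scale below each \<open>e\<close>.\<close>

lemma lower_packing_premeasure_eq_0:
  assumes "\<And>e. e > 0 \<Longrightarrow> \<exists>\<delta>>0. \<delta> < e \<and> covering_number \<delta> P * ennreal (\<delta> powr s) \<le> ennreal e"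
  shows "lower_packing_premeasure s P = 0"
proof (rule ccontr)
  assume "lower_packing_premeasure s P \<noteq> 0"
  then obtain z where z: "0 < z" "z < lower_packing_premeasure s P"
    using dense zero_less_iff_neq_zero by blast
  then obtain c where c: "z = ennreal c" "0 < c"
    by (cases z) (auto simp: top_unique)
  have "\<forall>\<^sub>F \<delta> in at_right 0. covering_number \<delta> P * ennreal (\<delta> powr s) > z"
    using z(2) unfolding lower_packing_premeasure_def by (rule less_LiminfD)
  then obtain b where b: "b > 0" "\<And>\<delta>. 0 < \<delta> \<Longrightarrow> \<delta> < b \<Longrightarrow> z < covering_number \<delta> P * ennreal (\<delta> powr s)"
    by (auto simp: eventually_at_right_field)
  \<comment> \<open>The error \<open>min b c\<close> bounds the scale by \<open>b\<close> and the
    value by \<open>c\<close> at once.\<close>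
  obtain \<delta> where "\<delta> > 0" "\<delta> < min b c"
      "covering_number \<delta> P * ennreal (\<delta> powr s) \<le> ennreal (min b c)"
    using assms[of "min b c"] b c by auto
  moreover have "ennreal (min b c) \<le> z" unfolding c by (intro ennreal_leI) simp
  ultimately show False using b(2)[of \<delta>] by (auto dest: order_trans simp: not_less[symmetric])
qed

lemma lower_packing_dim_le:
  assumes "E \<subseteq> (\<Union>n::nat. P n)" "\<And>n s. s > D \<Longrightarrow> lower_packing_premeasure s (P n) = 0" "0 \<le> D"
  shows "lower_packing_dim E \<le> ennreal D"
  unfolding lower_packing_dim_def
proof (rule Sup_least, clarify)
  fix s :: real assume s: "s > 0" "lower_packing_measure s E > 0"
  have "\<not> s > D"
  proof
    assume "s > D"
    have "lower_packing_measure s E \<le> (\<Sum>n. lower_packing_premeasure s (P n))"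
      unfolding lower_packing_measure_def by (rule Inf_lower) (use assms(1) in blast)
    also have "\<dots> = 0" using assms(2)[OF \<open>s > D\<close>] by simp
    finally show False using s by simp
  qed
  then show "ennreal s \<le> ennreal D" using s by (intro ennreal_leI) auto
qed

text \<open>The set \<open>E\<close> projects along axis \<open>k\<close> onto a facet. Volumes of
  boxes spanning the cube along this axis stand in for a measure on the facet. Having at least two
  coordinates makes \<open>m\<close> positive, as \<open>hausdorff_dim\<close> tests positive
  exponents only.\<close>

lemma hausdorff_dim_ge_if_meets_lines:
  fixes E :: "(real ^ 'n) set"
  assumes "CARD('n) \<ge> 2" and lines: "\<And>p. p \<in> cbox 0 1 \<Longrightarrow> \<exists>x\<in>E. \<forall>i. i \<noteq> k \<longrightarrow> x $ i = p $ i"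
  shows "of_nat (CARD('n) - 1) \<le> hausdorff_dim E"
proof -
  define m where "m = CARD('n) - 1"
  have m: "m > 0" using assms by (simp add: m_def)
  \<comment> \<open>A piece of diameter \<open>r\<close> serves only lines through a tube around it of volume at most
     \<open>(2 * r) ^ m\<close>, and these tubes cover the cube.\<close>
  have *: "ennreal ((1/2) ^ m) \<le> (\<Sum>n. ennreal (diameter (A n) powr m))"
    if E: "E \<subseteq> (\<Union>n. A n)" and bdd: "\<And>n. bounded (A n)" for A :: "nat \<Rightarrow> (real ^ 'n) set"
  proof -
    \<comment> \<open>For empty \<open>A n\<close> the point is arbitrary, but then
      \<open>r n = 0\<close> and the box has volume 0.\<close>
    define a where "a = (\<lambda>n. SOME x. x \<in> A n)"
    define r where "r = (\<lambda>n. diameter (A n))"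
    define lo hi where "lo = (\<lambda>n. (\<chi> i. if i = k then 0 else a n $ i - r n) :: real ^ 'n)"
      and "hi = (\<lambda>n. (\<chi> i. if i = k then 1 else a n $ i + r n) :: real ^ 'n)"
    have r: "r n \<ge> 0" for n using bdd by (simp add: r_def diameter_ge_0)
    have emeasure_cbox: "emeasure lborel (cbox u v) = ennreal (measure lborel (cbox u v))"
      for u v :: "real ^ 'n"
      by (rule emeasure_eq_ennreal_measure) (use emeasure_lborel_cbox_finite[of u v] in auto)
    have cov: "cbox 0 1 \<subseteq> (\<Union>n. cbox (lo n) (hi n))"
    proof
      fix p :: "real ^ 'n" assume p: "p \<in> cbox 0 1"
      then obtain x n where x: "x \<in> A n" "\<And>i. i \<noteq> k \<Longrightarrow> x $ i = p $ i"
        using lines E by blast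
      have "a n \<in> A n" unfolding a_def using x by (intro someI)
      then have "dist x (a n) \<le> r n"
        unfolding r_def using bdd x by (intro diameter_bounded_bound) auto
      then have comp: "\<bar>x $ i - a n $ i\<bar> \<le> r n" for i
        using component_le_norm_cart[of "x - a n" i] by (simp add: dist_norm)
      have "a n $ i - r n \<le> p $ i \<and> p $ i \<le> a n $ i + r n" if "i \<noteq> k" for i
        using x(2)[OF that] comp[of i] by linarith
      then have "p \<in> cbox (lo n) (hi n)"
        using p by (auto simp: mem_box_cart lo_def hi_def)
      then show "p \<in> (\<Union>n. cbox (lo n) (hi n))" by blast
    qed
    have vol: "emeasure lborel (cbox (lo n) (hi n)) = ennreal (2 ^ m) * ennreal (r n powr m)" for n
    proof -
      have "measure lborel (cbox (lo n) (hi n)) = (\<Prod>i\<in>UNIV. hi n $ i - lo n $ i)"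
        using r[of n] by (intro content_cbox_cart) (auto simp: interval_ne_empty_cart lo_def hi_def)
      also have "\<dots> = (\<Prod>i\<in>UNIV - {k}. hi n $ i - lo n $ i)"
        by (subst prod.remove[of _ k]) (auto simp: lo_def hi_def)
      also have "\<dots> = (\<Prod>i\<in>UNIV - {k}. 2 * r n)"
        by (intro prod.cong) (auto simp: lo_def hi_def)
      also have "\<dots> = (2 * r n) ^ m"
        by (simp add: m_def card_Diff_singleton)
      also have "\<dots> = 2 ^ m * r n powr m"
        using r[of n] m by (simp add: power_mult_distrib powr_realpow')
      finally show ?thesis by (simp add: emeasure_cbox ennreal_mult' del: emeasure_lborel_cbox_eq)
    qed
    have "1 = emeasure lborel (cbox (0::real ^ 'n) 1)"
    proof -
      have "measure lborel (cbox (0::real ^ 'n) 1) = 1"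
        by (subst content_cbox_cart) (auto simp: interval_ne_empty_cart)
      then show ?thesis by (simp add: emeasure_cbox del: emeasure_lborel_cbox_eq)
    qed
    also have "\<dots> \<le> emeasure lborel (\<Union>n. cbox (lo n) (hi n))"
      using cov by (intro emeasure_mono) auto
    also have "\<dots> \<le> (\<Sum>n. emeasure lborel (cbox (lo n) (hi n)))"
      by (rule emeasure_subadditive_countably) auto
    also have "\<dots> = ennreal (2 ^ m) * (\<Sum>n. ennreal (r n powr m))"
      unfolding vol by simp
    finally have "ennreal ((1/2) ^ m) * 1
        \<le> ennreal ((1/2) ^ m) * (ennreal (2 ^ m) * (\<Sum>n. ennreal (r n powr m)))"
      by (intro mult_left_mono) auto
    also have "\<dots> = (\<Sum>n. ennreal (r n powr m))"
      by (simp add: mult.assoc[symmetric] ennreal_mult[symmetric] power_mult_distrib[symmetric])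
    finally show ?thesis by (simp add: r_def)
  qed
  \<comment> \<open>Scale 1 is enough: the volume bound holds for every cover by bounded
    sets.\<close>
  have "ennreal ((1/2) ^ m) \<le> hausdorff_premeasure m 1 E"
    unfolding hausdorff_premeasure_def by (intro Inf_greatest) (use * in blast)
  also have "\<dots> \<le> hausdorff_measure m E"
    unfolding hausdorff_measure_def by (intro SUP_upper) auto
  finally have "0 < hausdorff_measure m E"
    by (rule less_le_trans[rotated]) auto
  then have "ennreal m \<le> hausdorff_dim E"
    unfolding hausdorff_dim_def using m by (intro Sup_upper) auto
  then show ?thesis by (simp add: m_def ennreal_of_nat_eq_real_of_nat)
qed

section \<open>Typical continuous functions on the cube\<close>

text \<open>The complement of an open dense set is closed with empty interior, hence nowhere
  dense.\<close>

lemma comeager_in_Inter_open_dense: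
  fixes G :: "nat \<Rightarrow> 'a set"
  assumes op: "\<And>n. openin X (G n)" and dense: "\<And>n. X closure_of G n = topspace X"
  shows "comeager_in X (topspace X \<inter> (\<Inter>n. G n))"
proof -
  have "nowhere_dense_in X (topspace X - G n)" for n
    unfolding nowhere_dense_in_def
    using op[of n] dense[of n] by (simp add: closure_of_closedin closedin_diff interior_of_complement)
  moreover have "topspace X - topspace X \<inter> (\<Inter>n. G n) = \<Union> (range (\<lambda>n. topspace X - G n))"
    by auto
  ultimately have "meager_in X (topspace X - topspace X \<inter> (\<Inter>n. G n))"
    unfolding meager_in_def by (intro exI[of _ "range (\<lambda>n. topspace X - G n)"]) auto
  then show ?thesis
    unfolding comeager_in_def by auto
qed

text \<open>Members of \<open>cfunspace\<close> are bounded continuous maps, and compactness of the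
  cube makes boundedness automatic.\<close>

lemma mem_cube_cfunspace:
  "f \<in> mspace (cube_cfunspace :: (real ^ 'n \<Rightarrow> real) metric) \<longleftrightarrow>
     f \<in> extensional (cbox 0 1) \<and> continuous_on (cbox 0 1) f"
proof -
  have "compactin (top_of_set (cbox 0 1)) (topspace (top_of_set (cbox (0::real ^ 'n) 1)))"
    by (simp add: compactin_subtopology)
  from compactin_mspace_cfunspace[OF this, of "euclidean_metric :: real metric"]
  show ?thesis by simp
qed

lemma cube_nonempty: "cbox (0::real ^ 'n) 1 \<noteq> {}"
  by (simp add: interval_ne_empty_cart)

text \<open>The assumption \<open>stable\<close> makes each condition open for the sup metric, and
  \<open>dense\<close> makes it dense.\<close>

lemma comeager_in_cube_cfunspace:
  fixes P :: "nat \<Rightarrow> (real ^ 'n \<Rightarrow> real) \<Rightarrow> bool"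
  assumes stable: "\<And>n f. P n f \<Longrightarrow> \<exists>e>0. \<forall>g. (\<forall>x\<in>cbox 0 1. \<bar>f x - g x\<bar> \<le> e) \<longrightarrow> P n g"
    and dense: "\<And>n f e. continuous_on (cbox 0 1) f \<Longrightarrow> e > 0 \<Longrightarrow>
        \<exists>g. continuous_on (cbox 0 1) g \<and> (\<forall>x\<in>cbox 0 1. \<bar>f x - g x\<bar> \<le> e) \<and> P n g"
  shows "comeager_in (mtopology_of cube_cfunspace) {f \<in> mspace cube_cfunspace. \<forall>n. P n f}"
proof -
  let ?M = "cube_cfunspace :: (real ^ 'n \<Rightarrow> real) metric"
  interpret Metric_space "mspace ?M" "mdist ?M" by (rule Metric_space_mspace_mdist)
  define G where "G = (\<lambda>n. {f \<in> mspace ?M. P n f})"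
  have "openin (mtopology_of ?M) (G n)" for n
    unfolding mtopology_of_def openin_mtopology
  proof (intro conjI allI impI)
    fix f assume f: "f \<in> G n"
    then obtain e where e: "e > 0" "\<And>g. (\<forall>x\<in>cbox 0 1. \<bar>f x - g x\<bar> \<le> e) \<Longrightarrow> P n g"
      using stable unfolding G_def by blast
    have "mball f e \<subseteq> G n"
    proof
      fix g assume g: "g \<in> mball f e"
      then have fg: "f \<in> mspace ?M" "g \<in> mspace ?M" "mdist ?M f g \<le> e" by (auto simp only: in_mball less_imp_le)
      have "\<bar>f x - g x\<bar> \<le> e" if "x \<in> cbox 0 1" for x
        using mdist_cfunspace_imp_mdist_le[OF fg, of x] that by (simp add: dist_real_def)
      with e(2) fg(2) show "g \<in> G n" unfolding G_def by blast
    qed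
    with e(1) show "\<exists>r>0. mball f r \<subseteq> G n" by blast
  qed (auto simp: G_def)
  moreover have "mtopology_of ?M closure_of G n = topspace (mtopology_of ?M)" for n
    unfolding mtopology_of_def metric_closure_of_alt topspace_mtopology
  proof (intro equalityI subsetI CollectI conjI allI impI)
    fix f and e :: real assume f: "f \<in> mspace ?M" and e: "e > 0"
    obtain g where g: "continuous_on (cbox 0 1) g" "\<And>x. x \<in> cbox 0 1 \<Longrightarrow> \<bar>f x - g x\<bar> \<le> e" "P n g"
      using dense[of f e n] f e unfolding mem_cube_cfunspace by blast
    \<comment> \<open>Elements of the space are \<open>undefined\<close> off the cube. As
      \<open>h\<close> agrees with \<open>g\<close> on the cube, stability carries
      \<open>P n\<close> over to \<open>h\<close>.\<close>
    define h where "h = restrict g (cbox 0 1)"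
    have hg: "h x = g x" if "x \<in> cbox 0 1" for x using that by (simp add: h_def)
    have h: "h \<in> mspace ?M"
      unfolding mem_cube_cfunspace using g(1) hg
      by (auto simp: h_def restrict_extensional cong: continuous_on_cong)
    have "P n h"
      using stable[OF g(3)] hg by fastforce
    moreover have "mdist ?M f h \<le> e"
      using e g(2) hg by (intro mdist_cfunspace_le) (auto simp: dist_real_def)
    ultimately show "\<exists>y\<in>G n. y \<in> mcball f e"
      using f h unfolding G_def by (intro bexI[of _ h]) (auto simp only: in_mcball mem_Collect_eq)
  qed blast
  ultimately have "comeager_in (mtopology_of ?M) (topspace (mtopology_of ?M) \<inter> (\<Inter>n. G n))"
    by (rule comeager_in_Inter_open_dense)
  also have "topspace (mtopology_of ?M) \<inter> (\<Inter>n. G n) = {f \<in> mspace ?M. \<forall>n. P n f}"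
    unfolding G_def topspace_mtopology_of by blast
  finally show ?thesis .
qed

section \<open>Points of infinite little lip on every line\<close>

text \<open>By the triangle inequality one half of an interval of slope \<open>K\<close> again has
  slope at least \<open>K\<close>. A radius between two consecutive lengths is served by the
  endpoints of the shorter interval, which costs the factor 2 in \<open>K / 2\<close>.\<close>

lemma bisect_steep_interval:
  fixes g :: "real \<Rightarrow> real"
  assumes "a < b" "K \<ge> 0" "K * (b - a) \<le> \<bar>g b - g a\<bar>"
  shows "\<exists>a' b' :: real. a \<le> a' \<and> b' \<le> b \<and> b' - a' = (b - a) / 2 ^ j \<and> K * (b' - a') \<le> \<bar>g b' - g a'\<bar> \<and>
    (\<forall>x\<in>{a'..b'}. \<forall>r. (b - a) / 2 ^ j \<le> r \<and> r \<le> b - a \<longrightarrow>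
      (\<exists>u\<in>{a..b} \<inter> cball x r. \<exists>v\<in>{a..b} \<inter> cball x r. K / 2 * r \<le> \<bar>g u - g v\<bar>))"
proof (induction j)
  case 0
  have "\<exists>u\<in>{a..b} \<inter> cball x r. \<exists>v\<in>{a..b} \<inter> cball x r. K / 2 * r \<le> \<bar>g u - g v\<bar>"
    if "x \<in> {a..b}" "r = b - a" for x r :: real
  proof (intro bexI)
    have "0 \<le> K * (b - a)" using assms by simp
    then have "K / 2 * (b - a) \<le> K * (b - a)" by simp
    then have "K / 2 * (b - a) \<le> \<bar>g b - g a\<bar>" using assms(3) by (rule order_trans)
    then show "K / 2 * r \<le> \<bar>g b - g a\<bar>" unfolding that(2) .
  qed (use that assms in \<open>auto simp: dist_real_def\<close>)
  then show ?case
    using assms by (intro exI[of _ a] exI[of _ b]) auto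
next
  case (Suc j)
  then obtain a1 b1 where 1: "a \<le> a1" "b1 \<le> b" "b1 - a1 = (b - a) / 2 ^ j" "K * (b1 - a1) \<le> \<bar>g b1 - g a1\<bar>"
    and cov: "\<And>x r. x \<in> {a1..b1} \<Longrightarrow> (b - a) / 2 ^ j \<le> r \<Longrightarrow> r \<le> b - a \<Longrightarrow>
      \<exists>u\<in>{a..b} \<inter> cball x r. \<exists>v\<in>{a..b} \<inter> cball x r. K / 2 * r \<le> \<bar>g u - g v\<bar>"
    by blast
  define c where "c = (a1 + b1) / 2"
  have lt: "a1 < b1" 
  proof -
    have "0 < (b - a) / 2 ^ j" using assms(1) by simp
    then show ?thesis using 1(3) by linarith
  qed
  have c: "c - a1 = (b1 - a1) / 2" "b1 - c = (b1 - a1) / 2" by (auto simp: c_def field_simps)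
  have "K * (b1 - a1) \<le> \<bar>g b1 - g c\<bar> + \<bar>g c - g a1\<bar>" using 1(4) by linarith
  then have "K * ((b1 - a1) / 2) \<le> \<bar>g c - g a1\<bar> \<or> K * ((b1 - a1) / 2) \<le> \<bar>g b1 - g c\<bar>"
    by argo
  then have "\<exists>a2 b2 :: real. a1 \<le> a2 \<and> b2 \<le> b1 \<and> b2 - a2 = (b1 - a1) / 2 \<and> K * (b2 - a2) \<le> \<bar>g b2 - g a2\<bar>"
  proof
    assume "K * ((b1 - a1) / 2) \<le> \<bar>g c - g a1\<bar>"
    then have "K * (c - a1) \<le> \<bar>g c - g a1\<bar>" by (simp only: c)
    then show ?thesis using c lt by (intro exI[of _ a1] exI[of _ c]) linarith
  next
    assume "K * ((b1 - a1) / 2) \<le> \<bar>g b1 - g c\<bar>"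
    then have "K * (b1 - c) \<le> \<bar>g b1 - g c\<bar>" by (simp only: c)
    then show ?thesis using c lt by (intro exI[of _ c] exI[of _ b1]) linarith
  qed
  then obtain a2 b2 :: real where 2: "a1 \<le> a2" "b2 \<le> b1" "b2 - a2 = (b1 - a1) / 2" "K * (b2 - a2) \<le> \<bar>g b2 - g a2\<bar>"
    by blast
  have "\<exists>u\<in>{a..b} \<inter> cball x r. \<exists>v\<in>{a..b} \<inter> cball x r. K / 2 * r \<le> \<bar>g u - g v\<bar>"
    if x: "x \<in> {a2..b2}" and r: "(b - a) / 2 ^ Suc j \<le> r" "r \<le> b - a" for x r :: real
  proof (cases "(b - a) / 2 ^ j \<le> r")
    case True
    then show ?thesis using cov x r 2 by auto
  next
    case False
    then have "r \<le> b1 - a1" unfolding 1(3) by (simp only: not_le less_imp_le)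
    then have "r / 2 \<le> b2 - a2" unfolding 2(3) by simp
    then have "K * (r / 2) \<le> K * (b2 - a2)" using assms by (intro mult_left_mono)
    then have "K * (r / 2) \<le> \<bar>g b2 - g a2\<bar>" using 2(4) by (rule order_trans)
    then have "K / 2 * r \<le> \<bar>g b2 - g a2\<bar>" by simp
    moreover have "b2 - a2 = (b - a) / 2 ^ Suc j" using 1 2 by simp
    with r have "b2 - a2 \<le> r" by simp
    ultimately show ?thesis
      using x 1 2 lt by (intro bexI[of _ b2] bexI[of _ a2]) (auto simp: dist_real_def)
  qed
  moreover have "b2 - a2 = (b - a) / 2 ^ Suc j" using 1 2 by simp
  ultimately show ?case
    using 1 2 by (intro exI[of _ a2] exI[of _ b2]) auto
qed

text \<open>
  Bisection down to the scale of a steep window covers the radii above that scale; the window itself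
  covers those below it, because the two points where it is steep may be arbitrarily close.
\<close>

lemma steeper_subinterval:
  fixes g :: "real \<Rightarrow> real"
  assumes windows: "\<And>N::nat. \<exists>h::real. 0 < h \<and> h < 1 / Suc N \<and>
      (\<forall>t. 0 \<le> t \<and> t + h \<le> 1 \<longrightarrow> (\<exists>p\<in>{t..t+h}. \<exists>q\<in>{t..t+h}. N * h < \<bar>g p - g q\<bar>))"
    and ab: "0 \<le> a" "a < b" "b \<le> 1" and K: "K \<ge> 0" "K * (b - a) \<le> \<bar>g b - g a\<bar>"
    and n: "K \<le> real n"
  shows "\<exists>a' b' :: real. a \<le> a' \<and> a' < b' \<and> b' \<le> b \<and> b' - a' \<le> (b - a) / 2 \<and>
    real n * (b' - a') \<le> \<bar>g b' - g a'\<bar> \<and>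
    (\<forall>x\<in>{a'..b'}. \<forall>r. b' - a' \<le> r \<and> r \<le> b - a \<longrightarrow>
      (\<exists>u\<in>{a..b} \<inter> cball x r. \<exists>v\<in>{a..b} \<inter> cball x r. K / 2 * r \<le> \<bar>g u - g v\<bar>))"
proof -
  have "0 < (b - a) / 2" using ab by simp
  from reals_Archimedean[OF this] obtain N0 where N0: "1 / real (Suc N0) < (b - a) / 2"
    unfolding inverse_eq_divide by blast
  \<comment> \<open>\<open>N0\<close> makes the window shorter than half of the interval, and
    \<open>n\<close> makes it steep enough.\<close>
  define N where "N = max N0 n"
  obtain h :: real where h: "0 < h" "h < 1 / Suc N"
    and win: "\<And>t. 0 \<le> t \<Longrightarrow> t + h \<le> 1 \<Longrightarrow> \<exists>p\<in>{t..t+h}. \<exists>q\<in>{t..t+h}. N * h < \<bar>g p - g q\<bar>"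
    using windows[of N] by blast
  have "1 / real (Suc N) \<le> 1 / Suc N0" by (simp add: N_def frac_le)
  then have hb: "h < (b - a) / 2" using N0 h by linarith
  have "\<exists>j. (b - a) / 2 ^ j < h"
  proof -
    obtain j where "(1/2) ^ j < h / (b - a)"
      using real_arch_pow_inv[of "h / (b - a)" "1/2"] h ab by auto
    then show ?thesis using ab by (intro exI[of _ j]) (simp add: field_simps power_one_over)
  qed
  \<comment> \<open>The depth \<open>j\<close> just before \<open>j0\<close> is the last one of
    length at least \<open>h\<close>: a window still fits there, and the length is below
    \<open>2 * h\<close>.\<close>
  define j0 where "j0 = (LEAST j. (b - a) / 2 ^ j < h)"
  have j0: "(b - a) / 2 ^ j0 < h"
    unfolding j0_def by (rule LeastI_ex) fact
  have j0_least: "\<not> (b - a) / 2 ^ i < h" if "i < j0" for i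
    using not_less_Least[OF that[unfolded j0_def]] .
  have "j0 \<noteq> 0" using j0 hb ab by (intro notI) simp
  then obtain j where j: "j0 = Suc j" by (cases j0) auto
  have j1: "h \<le> (b - a) / 2 ^ j" and j2: "(b - a) / 2 ^ j < 2 * h"
    using j0 j0_least[of j] unfolding j by auto
  obtain a1 b1 where 1: "a \<le> a1" "b1 \<le> b" "b1 - a1 = (b - a) / 2 ^ j"
    and cov: "\<And>x r. x \<in> {a1..b1} \<Longrightarrow> (b - a) / 2 ^ j \<le> r \<Longrightarrow> r \<le> b - a \<Longrightarrow>
      \<exists>u\<in>{a..b} \<inter> cball x r. \<exists>v\<in>{a..b} \<inter> cball x r. K / 2 * r \<le> \<bar>g u - g v\<bar>"
    using bisect_steep_interval[OF ab(2) K, of j] by blast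
  have sub: "a1 + h \<le> b1" using 1 j1 by linarith
  obtain p q where pq: "p \<in> {a1..a1+h}" "q \<in> {a1..a1+h}" "N * h < \<bar>g p - g q\<bar>"
    using win[of a1] 1 sub ab by auto
  define a2 b2 where "a2 = min p q" and "b2 = max p q"
  have g2: "N * h < \<bar>g b2 - g a2\<bar>" using pq(3) by (auto simp: a2_def b2_def min_def max_def)
  have "0 \<le> N * h" using h by simp
  then have "a2 \<noteq> b2" using g2 by auto
  then have 2: "a1 \<le> a2" "a2 < b2" "b2 \<le> a1 + h" using pq by (auto simp: a2_def b2_def)
  have steep: "n * s \<le> \<bar>g b2 - g a2\<bar>" if "0 \<le> s" "s \<le> h" for s :: real
  proof -
    have "n * s \<le> N * h" using that by (intro mult_mono) (auto simp: N_def)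
    then show ?thesis using g2 by linarith
  qed
  have "\<exists>u\<in>{a..b} \<inter> cball x r. \<exists>v\<in>{a..b} \<inter> cball x r. K / 2 * r \<le> \<bar>g u - g v\<bar>"
    if x: "x \<in> {a2..b2}" and r: "b2 - a2 \<le> r" "r \<le> b - a" for x r :: real
  proof (cases "(b - a) / 2 ^ j \<le> r")
    case True
    then show ?thesis using cov x r 2 sub by auto
  next
    case False
    \<comment> \<open>Here \<open>r < 2 * h\<close>, so \<open>r / 2 \<le> h\<close> and the
      oscillation over the window dominates.\<close>
    then have "n * (r / 2) \<le> \<bar>g b2 - g a2\<bar>" using j2 2 r by (intro steep) auto
    moreover have "K * (r / 2) \<le> n * (r / 2)" using n 2 r by (intro mult_right_mono) auto
    ultimately have "K / 2 * r \<le> \<bar>g b2 - g a2\<bar>" by simp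
    then show ?thesis
      using x r 1 2 sub by (intro bexI[of _ b2] bexI[of _ a2]) (auto simp: dist_real_def)
  qed
  then show ?thesis
    using 1 2 sub hb steep[of "b2 - a2"] by (intro exI[of _ a2] exI[of _ b2]) auto
qed

text \<open>Nested intervals are chosen with slope at least \<open>k\<close> at stage
  \<open>k\<close>, their lengths at least halving. A small radius lies between two consecutive
  lengths, where slope \<open>k / 2\<close> is seen around the common point.\<close>

lemma exists_point_of_infinite_steepness:
  fixes g :: "real \<Rightarrow> real"
  assumes windows: "\<And>N::nat. \<exists>h::real. 0 < h \<and> h < 1 / Suc N \<and>
      (\<forall>t. 0 \<le> t \<and> t + h \<le> 1 \<longrightarrow> (\<exists>p\<in>{t..t+h}. \<exists>q\<in>{t..t+h}. N * h < \<bar>g p - g q\<bar>))"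
  shows "\<exists>x\<in>{0..1}. \<forall>M. \<exists>r0>0. \<forall>r. 0 < r \<and> r < r0 \<longrightarrow>
    (\<exists>u\<in>{0..1} \<inter> cball x r. \<exists>v\<in>{0..1} \<inter> cball x r. M * r \<le> \<bar>g u - g v\<bar>)"
proof -
  define P where "P = (\<lambda>k (a, b). 0 \<le> a \<and> a < b \<and> b \<le> 1 \<and> real k * (b - a) \<le> \<bar>g b - g a\<bar>)"
  define Q where "Q = (\<lambda>(k::nat) (a, b) (a', b'). a \<le> a' \<and> b' \<le> b \<and> b' - a' \<le> (b - a) / 2 \<and>
    (\<forall>x\<in>{a'..b'}. \<forall>r. b' - a' \<le> r \<and> r \<le> b - a \<longrightarrow>
      (\<exists>u\<in>{a..b} \<inter> cball x r. \<exists>v\<in>{a..b} \<inter> cball x r. k / 2 * r \<le> \<bar>g u - g v\<bar>)))"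
  have "\<exists>F. \<forall>k. P k (F k) \<and> Q k (F k) (F (Suc k))"
  proof (rule dependent_nat_choice)
    show "\<exists>x. P 0 x" by (intro exI[of _ "(0, 1)"]) (simp add: P_def)
  next
    fix x and k :: nat assume "P k x"
    then obtain a b where x: "x = (a, b)" and ab: "0 \<le> a" "a < b" "b \<le> 1" "real k * (b - a) \<le> \<bar>g b - g a\<bar>"
      by (auto simp: P_def)
    from steeper_subinterval[OF windows ab(1-3) _ ab(4), of "Suc k"]
    obtain a' b' where "a \<le> a'" "a' < b'" "b' \<le> b" "b' - a' \<le> (b - a) / 2"
      "real (Suc k) * (b' - a') \<le> \<bar>g b' - g a'\<bar>"
      "\<forall>x\<in>{a'..b'}. \<forall>r. b' - a' \<le> r \<and> r \<le> b - a \<longrightarrow>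
        (\<exists>u\<in>{a..b} \<inter> cball x r. \<exists>v\<in>{a..b} \<inter> cball x r. k / 2 * r \<le> \<bar>g u - g v\<bar>)"
      by (auto simp del: of_nat_Suc)
    then show "\<exists>y. P (Suc k) y \<and> Q k x y"
      using ab unfolding x P_def Q_def by (intro exI[of _ "(a', b')"]) (auto simp del: of_nat_Suc)
  qed
  then obtain F where F: "\<And>k. P k (F k)" "\<And>k. Q k (F k) (F (Suc k))" by blast
  define a b where "a = (\<lambda>k. fst (F k))" and "b = (\<lambda>k. snd (F k))"
  have ab: "0 \<le> a k" "a k < b k" "b k \<le> 1" for k
    using F(1)[of k] by (auto simp: a_def b_def P_def split: prod.splits)
  have nest: "a k \<le> a (Suc k)" "b (Suc k) \<le> b k" "b (Suc k) - a (Suc k) \<le> (b k - a k) / 2"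
    and steep: "\<And>x r. x \<in> {a (Suc k)..b (Suc k)} \<Longrightarrow> b (Suc k) - a (Suc k) \<le> r \<Longrightarrow> r \<le> b k - a k \<Longrightarrow>
      \<exists>u\<in>{a k..b k} \<inter> cball x r. \<exists>v\<in>{a k..b k} \<inter> cball x r. k / 2 * r \<le> \<bar>g u - g v\<bar>" for k
    using F(2)[of k] by (auto simp: a_def b_def Q_def split: prod.splits)
  have len: "b k - a k \<le> (1/2) ^ k" for k
  proof (induction k)
    case (Suc k)
    then show ?case using nest(3)[of k] by simp
  qed (use ab[of 0] in simp)
  have "incseq a" "decseq b" using nest by (auto intro: incseq_SucI decseq_SucI)
  have "a m \<le> b k" for m k
    using incseqD[OF \<open>incseq a\<close>, of m "max m k"] decseqD[OF \<open>decseq b\<close>, of k "max m k"] ab(2)[of "max m k"]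
    by auto
  then have ub: "(SUP k. a k) \<le> b k" for k by (intro cSUP_least) auto
  have "bdd_above (range a)" using \<open>\<And>m k. a m \<le> b k\<close> by (intro bdd_aboveI[of _ "b 0"]) auto
  then have lb: "a k \<le> (SUP k. a k)" for k by (intro cSUP_upper) auto
  obtain x where x: "\<And>k. x \<in> {a k..b k}"
    using that[of "SUP k. a k"] lb ub by auto
  have "\<exists>r0>0. \<forall>r. 0 < r \<and> r < r0 \<longrightarrow>
    (\<exists>u\<in>{0..1} \<inter> cball x r. \<exists>v\<in>{0..1} \<inter> cball x r. M * r \<le> \<bar>g u - g v\<bar>)" for M
  proof -
    obtain K :: nat where K: "2 * M \<le> K" using real_arch_simple by blast
    have "\<exists>u\<in>{0..1} \<inter> cball x r. \<exists>v\<in>{0..1} \<inter> cball x r. M * r \<le> \<bar>g u - g v\<bar>"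
      if r: "0 < r" "r < b K - a K" for r
    proof -
      obtain i where "(1/2) ^ i < r" using real_arch_pow_inv[of r "1/2"] r by auto
      then have ex: "b i - a i \<le> r" using len[of i] by linarith
      \<comment> \<open>Since \<open>r\<close> is below the length at stage \<open>K\<close>, this
        first stage of length at most \<open>r\<close> comes after \<open>K\<close>; its predecessor
        \<open>k \<ge> K\<close> is longer than \<open>r\<close>.\<close>
      define j where "j = (LEAST j. b j - a j \<le> r)"
      have j: "b j - a j \<le> r" unfolding j_def by (rule LeastI) (rule ex)
      have "K < j"
      proof (rule ccontr)
        assume "\<not> K < j"
        then have "b K - a K \<le> b j - a j"
          using incseqD[OF \<open>incseq a\<close>, of j K] decseqD[OF \<open>decseq b\<close>, of j K] by auto
        then show False using j r by linarith
      qed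
      then obtain k where k: "j = Suc k" "K \<le> k" by (cases j) auto
      have "r < b k - a k" 
      proof -
        have "k < (LEAST j. b j - a j \<le> r)" using k(1) unfolding j_def by simp
        then have "\<not> b k - a k \<le> r" by (rule not_less_Least)
        then show ?thesis by simp
      qed
      then obtain u v where uv: "u \<in> {a k..b k} \<inter> cball x r" "v \<in> {a k..b k} \<inter> cball x r"
          "k / 2 * r \<le> \<bar>g u - g v\<bar>"
        using steep[OF x[of "Suc k"], of r] j unfolding k(1) by force
      have "M * r \<le> k / 2 * r" using K k r by (intro mult_right_mono) auto
      then show ?thesis
        using uv ab[of k] by (intro bexI[of _ u] bexI[of _ v]) auto
    qed
    then show ?thesis using ab[of K] by (intro exI[of _ "b K - a K"]) auto
  qed
  moreover have "x \<in> {0..1}" using x[of 0] ab[of 0] by auto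
  ultimately show ?thesis by blast
qed

section \<open>Steep windows on lines parallel to an axis\<close>

definition set_coord :: "'n \<Rightarrow> real \<Rightarrow> real ^ 'n \<Rightarrow> real ^ 'n::finite" where
  "set_coord k a p = (\<chi> i. if i = k then a else p $ i)"

lemma dist_set_coord: "dist (set_coord k a p) (set_coord k b p) = \<bar>a - b\<bar>"
proof -
  have "set_coord k a p - set_coord k b p = (a - b) *\<^sub>R axis k 1"
    by (simp add: set_coord_def vec_eq_iff axis_def)
  then show ?thesis by (simp add: dist_norm)
qed

lemma set_coord_in_cube:
  assumes "p \<in> cbox 0 1" "a \<in> {0..1}"
  shows "set_coord k a p \<in> cbox 0 1"
  using assms by (auto simp: mem_box_cart set_coord_def)

text \<open>The margin \<open>e\<close>, uniform over lines and windows, makes the condition open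
  under uniform perturbation of \<open>f\<close>.\<close>

definition steep_windows :: "'n::finite \<Rightarrow> nat \<Rightarrow> (real ^ 'n \<Rightarrow> real) \<Rightarrow> bool" where
  "steep_windows k n f \<longleftrightarrow> (\<exists>h e :: real. 0 < h \<and> h < 1 / Suc n \<and> 0 < e \<and>
     (\<forall>p\<in>cbox 0 1. \<forall>t. 0 \<le> t \<and> t + h \<le> 1 \<longrightarrow>
       (\<exists>a\<in>{t..t+h}. \<exists>b\<in>{t..t+h}. n * h + e \<le> \<bar>f (set_coord k a p) - f (set_coord k b p)\<bar>)))"

lemma steep_windows_stable:
  fixes f :: "real ^ 'n \<Rightarrow> real"
  assumes "steep_windows k n f"
  shows "\<exists>e>0. \<forall>g. (\<forall>x\<in>cbox 0 1. \<bar>f x - g x\<bar> \<le> e) \<longrightarrow> steep_windows k n g"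
proof -
  obtain h e :: real where he: "0 < h" "h < 1 / Suc n" "0 < e"
    and win: "\<And>p t. p \<in> cbox 0 1 \<Longrightarrow> 0 \<le> t \<Longrightarrow> t + h \<le> 1 \<Longrightarrow>
      \<exists>a\<in>{t..t+h}. \<exists>b\<in>{t..t+h}. n * h + e \<le> \<bar>f (set_coord k a p) - f (set_coord k b p)\<bar>"
    using assms unfolding steep_windows_def by blast
  have "steep_windows k n g" if g: "\<forall>x\<in>cbox 0 1. \<bar>f x - g x\<bar> \<le> e / 4" for g
    unfolding steep_windows_def
  proof (intro exI conjI ballI allI impI)
    fix p :: "real ^ 'n" and t :: real
    assume p: "p \<in> cbox 0 1" and t: "0 \<le> t \<and> t + h \<le> 1"
    obtain a b where ab: "a \<in> {t..t+h}" "b \<in> {t..t+h}"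
        "n * h + e \<le> \<bar>f (set_coord k a p) - f (set_coord k b p)\<bar>"
      using win[OF p] t by blast
    have "set_coord k a p \<in> cbox 0 1" "set_coord k b p \<in> cbox 0 1"
      using ab t by (auto intro!: set_coord_in_cube p)
    with g have "\<bar>f (set_coord k a p) - g (set_coord k a p)\<bar> \<le> e / 4"
        "\<bar>f (set_coord k b p) - g (set_coord k b p)\<bar> \<le> e / 4" by auto
    then have "n * h + e / 2 \<le> \<bar>g (set_coord k a p) - g (set_coord k b p)\<bar>"
      using ab(3) by linarith
    then show "\<exists>a\<in>{t..t+h}. \<exists>b\<in>{t..t+h}. n * h + e / 2 \<le> \<bar>g (set_coord k a p) - g (set_coord k b p)\<bar>"
      using ab(1,2) by blast
  qed (use he in auto)
  then show ?thesis using he(3) by (intro exI[of _ "e / 4"]) auto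
qed

text \<open>A cosine of amplitude \<open>e\<close> and period \<open>h / 2\<close> has a crest and a
  following trough in every window; its drop \<open>2 * e\<close> outweighs the change of
  \<open>f\<close>, which is below \<open>e / 2\<close>.\<close>

lemma steep_windows_dense:
  fixes f :: "real ^ 'n \<Rightarrow> real"
  assumes f: "continuous_on (cbox 0 1) f" and e: "e > 0"
  shows "\<exists>g. continuous_on (cbox 0 1) g \<and> (\<forall>x\<in>cbox 0 1. \<bar>f x - g x\<bar> \<le> e) \<and> steep_windows k n g"
proof -
  have "uniformly_continuous_on (cbox 0 1) f"
    using f by (intro compact_uniformly_continuous) auto
  then obtain d where d: "d > 0" "\<And>x y. x \<in> cbox 0 1 \<Longrightarrow> y \<in> cbox 0 1 \<Longrightarrow> dist y x < d \<Longrightarrow> dist (f y) (f x) < e / 2"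
    using e unfolding uniformly_continuous_on_def by (meson half_gt_zero)
  \<comment> \<open>The three bounds control \<open>f\<close> across a window, keep the window
    shorter than \<open>1 / Suc n\<close>, and give \<open>n * h \<le> e\<close>.\<close>
  define m where "m = min d (min (1 / Suc n) (e / Suc n))"
  have "0 < m" using d e by (simp add: m_def)
  define h where "h = m / 2"
  have "m \<le> d" "m \<le> 1 / Suc n" "m \<le> e / Suc n" by (simp_all add: m_def)
  moreover have "0 < h" "h < m" using \<open>0 < m\<close> by (simp_all add: h_def)
  ultimately have h: "0 < h" "h < d" "h < 1 / Suc n" "h \<le> e / Suc n" by simp_all
  have "n * h \<le> Suc n * (e / Suc n)" using h e by (intro mult_mono) auto
  then have nh: "n * h \<le> e" by simp
  define g where "g = (\<lambda>x::real ^ 'n. f x + e * cos (4 * pi * x $ k / h))"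
  have "continuous_on (cbox 0 1) g"
    unfolding g_def using h by (intro continuous_intros f) auto
  moreover have "\<bar>f x - g x\<bar> \<le> e" for x
    using e abs_cos_le_one[of "4 * pi * x $ k / h"] by (simp add: g_def abs_mult)
  moreover have "steep_windows k n g"
    unfolding steep_windows_def
  proof (intro exI conjI ballI allI impI)
    fix p :: "real ^ 'n" and t :: real
    assume p: "p \<in> cbox 0 1" and t: "0 \<le> t \<and> t + h \<le> 1"
    \<comment> \<open>Crests are the multiples of \<open>h / 2\<close>: \<open>a\<close> is the
      first one not before \<open>t\<close>, and \<open>b\<close> is the next trough.\<close>
    define j where "j = \<lceil>2 * t / h\<rceil>"
    define a b where "a = j * h / 2" and "b = a + h / 4"
    have "2 * t / h \<le> j" "j < 2 * t / h + 1" unfolding j_def by linarith+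
    then have "t \<le> a" "a < t + h / 2" using h unfolding a_def by (auto simp: field_simps)
    then have ab: "a \<in> {t..t+h}" "b \<in> {t..t+h}" "a \<in> {0..1}" "b \<in> {0..1}"
      using t h unfolding b_def by auto
    have "4 * pi * a / h = 2 * pi * j" "4 * pi * b / h = 2 * pi * j + pi"
      using h by (auto simp: a_def b_def field_simps)
    then have cos: "cos (4 * pi * a / h) = 1" "cos (4 * pi * b / h) = - 1"
      by (simp_all add: cos_int_2pin)
    have "\<bar>a - b\<bar> < d" using h by (simp add: b_def)
    then have "dist (f (set_coord k a p)) (f (set_coord k b p)) < e / 2"
      using ab p by (intro d(2) set_coord_in_cube) (auto simp: dist_set_coord)
    moreover have "g (set_coord k a p) = f (set_coord k a p) + e"
      "g (set_coord k b p) = f (set_coord k b p) - e"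
      using cos by (simp_all add: g_def set_coord_def)
    ultimately have "n * h + e / 2 \<le> \<bar>g (set_coord k a p) - g (set_coord k b p)\<bar>"
      using nh unfolding dist_real_def by linarith
    then show "\<exists>a\<in>{t..t+h}. \<exists>b\<in>{t..t+h}. n * h + e / 2 \<le> \<bar>g (set_coord k a p) - g (set_coord k b p)\<bar>"
      using ab by blast
  qed (use e h in auto)
  ultimately show ?thesis by blast
qed

lemma little_lip_ge:
  fixes f :: "real ^ 'n \<Rightarrow> real"
  assumes "bounded (f ` S)" "r0 > 0"
    and "\<And>r. 0 < r \<Longrightarrow> r < r0 \<Longrightarrow> \<exists>u\<in>S \<inter> cball x r. \<exists>v\<in>S \<inter> cball x r. M * r \<le> \<bar>f u - f v\<bar>"
  shows "ennreal M \<le> little_lip S f x"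
  unfolding little_lip_def
proof (rule Liminf_bounded)
  have "ennreal M \<le> ennreal (diameter (f ` (S \<inter> cball x r)) / r)" if r: "0 < r" "r < r0" for r
  proof -
    obtain u v where uv: "u \<in> S \<inter> cball x r" "v \<in> S \<inter> cball x r" "M * r \<le> \<bar>f u - f v\<bar>"
      using assms(3)[OF r] by blast
    have "bounded (f ` (S \<inter> cball x r))" using assms(1) by (rule bounded_subset) auto
    then have "dist (f u) (f v) \<le> diameter (f ` (S \<inter> cball x r))"
      using uv by (intro diameter_bounded_bound) auto
    then show ?thesis
      using uv r by (intro ennreal_leI) (simp add: field_simps dist_real_def)
  qed
  then show "\<forall>\<^sub>F r in at_right 0. ennreal M \<le> ennreal (diameter (f ` (S \<inter> cball x r)) / r)"
    unfolding eventually_at_right_field using assms(2) by blast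
qed

text \<open>The line is embedded isometrically by \<open>set_coord\<close>, so steepness of the
  restriction at all small radii passes to \<open>f\<close> on balls of the same radius.\<close>

lemma infinite_little_lip_on_line:
  fixes f :: "real ^ 'n \<Rightarrow> real"
  assumes f: "continuous_on (cbox 0 1) f" and steep: "\<And>n. steep_windows k n f" and p: "p \<in> cbox 0 1"
  shows "\<exists>x\<in>cbox 0 1. little_lip (cbox 0 1) f x = \<infinity> \<and> (\<forall>i. i \<noteq> k \<longrightarrow> x $ i = p $ i)"
proof -
  have "\<exists>h::real. 0 < h \<and> h < 1 / Suc N \<and> (\<forall>t. 0 \<le> t \<and> t + h \<le> 1 \<longrightarrow>
      (\<exists>a\<in>{t..t+h}. \<exists>b\<in>{t..t+h}. N * h < \<bar>f (set_coord k a p) - f (set_coord k b p)\<bar>))" for N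
  proof -
    obtain h e :: real where he: "0 < h" "h < 1 / Suc N" "0 < e"
      and win: "\<And>t. 0 \<le> t \<Longrightarrow> t + h \<le> 1 \<Longrightarrow>
        \<exists>a\<in>{t..t+h}. \<exists>b\<in>{t..t+h}. N * h + e \<le> \<bar>f (set_coord k a p) - f (set_coord k b p)\<bar>"
      using steep[of N] p unfolding steep_windows_def by blast
    have less: "N * h < z" if "N * h + e \<le> z" for z using that he by linarith
    show ?thesis using he(1,2) win less by (intro exI[of _ h]) blast
  qed
  from exists_point_of_infinite_steepness[OF this] obtain x where x: "x \<in> {0..1}"
    and sharp: "\<And>M. \<exists>r0>0. \<forall>r. 0 < r \<and> r < r0 \<longrightarrow> (\<exists>u\<in>{0..1} \<inter> cball x r. \<exists>v\<in>{0..1} \<inter> cball x r.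
        M * r \<le> \<bar>f (set_coord k u p) - f (set_coord k v p)\<bar>)"
    by blast
  let ?x = "set_coord k x p"
  have bdd: "bounded (f ` cbox 0 1)"
    using f by (intro compact_imp_bounded compact_continuous_image) auto
  have "ennreal M \<le> little_lip (cbox 0 1) f ?x" for M
  proof -
    obtain r0 where r0: "r0 > 0" and uv: "\<And>r. 0 < r \<Longrightarrow> r < r0 \<Longrightarrow>
        \<exists>u\<in>{0..1} \<inter> cball x r. \<exists>v\<in>{0..1} \<inter> cball x r. M * r \<le> \<bar>f (set_coord k u p) - f (set_coord k v p)\<bar>"
      using sharp[of M] by blast
    show ?thesis
    proof (rule little_lip_ge[OF bdd r0])
      fix r assume "0 < r" "r < r0"
      then obtain u v where "u \<in> {0..1} \<inter> cball x r" "v \<in> {0..1} \<inter> cball x r"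
          "M * r \<le> \<bar>f (set_coord k u p) - f (set_coord k v p)\<bar>"
        using uv by blast
      then show "\<exists>u\<in>cbox 0 1 \<inter> cball ?x r. \<exists>v\<in>cbox 0 1 \<inter> cball ?x r. M * r \<le> \<bar>f u - f v\<bar>"
        using p by (intro bexI[of _ "set_coord k u p"] bexI[of _ "set_coord k v p"])
          (auto simp: dist_set_coord dist_real_def intro!: set_coord_in_cube)
    qed
  qed
  then have "little_lip (cbox 0 1) f ?x = \<infinity>"
  proof (cases "little_lip (cbox 0 1) f ?x")
    case (real r)
    then show ?thesis
      using \<open>\<And>M. ennreal M \<le> little_lip (cbox 0 1) f ?x\<close>[of "r + 1"] by simp
  qed simp
  then show ?thesis
    using x p by (intro bexI[of _ ?x]) (auto simp: set_coord_def intro: set_coord_in_cube[unfolded set_coord_def])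
qed

section \<open>Covering numbers of spherical shells\<close>

lemma covering_number_le_card:
  assumes "finite F" "0 \<le> \<delta>" "Z \<subseteq> (\<Union>x\<in>F. cball x (\<delta> / 2))"
  shows "covering_number \<delta> (Z :: 'a::euclidean_space set) \<le> ennreal (card F)"
proof -
  have "covering_number \<delta> Z \<le> of_nat (card ((\<lambda>x. cball x (\<delta> / 2)) ` F))"
    unfolding covering_number_def by (rule Inf_lower) (use assms in \<open>auto simp: diameter_cball\<close>)
  also have "\<dots> \<le> of_nat (card F)"
    using assms(1) by (intro of_nat_mono card_image_le)
  finally show ?thesis by (simp add: ennreal_of_nat_eq_real_of_nat)
qed

text \<open>Balls of radius \<open>\<delta> / 4\<close> about a
  \<open>\<delta> / 2\<close>-separated subset of \<open>Z\<close> are disjoint and lie in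
  \<open>W\<close>, so volume bounds its cardinality. For a maximal such subset the balls of radius
  \<open>\<delta> / 2\<close> cover \<open>Z\<close>.\<close>

lemma covering_number_le_volume:
  fixes Z :: "'a::euclidean_space set"
  assumes \<delta>: "\<delta> > 0" and W: "W \<in> lmeasurable" and sub: "\<And>z. z \<in> Z \<Longrightarrow> cball z (\<delta> / 4) \<subseteq> W"
  shows "covering_number \<delta> Z
    \<le> ennreal (measure lebesgue W / (unit_ball_vol DIM('a) * (\<delta> / 4) ^ DIM('a)))"
proof -
  define v where "v = unit_ball_vol DIM('a) * (\<delta> / 4) ^ DIM('a)"
  have v: "v > 0" using \<delta> by (simp add: v_def)
  define sep where "sep = (\<lambda>F. finite F \<and> F \<subseteq> Z \<and> pairwise (\<lambda>x y. \<delta> / 2 < dist x y) F)"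
  have card: "card F \<le> measure lebesgue W / v" if "sep F" for F
  proof -
    have F: "finite F" "F \<subseteq> Z" "pairwise (\<lambda>x y. \<delta> / 2 < dist x y) F" using that by (auto simp: sep_def)
    have "disjoint_family_on (\<lambda>x. cball x (\<delta> / 4)) F"
      unfolding disjoint_family_on_def
    proof (intro ballI impI, rule ccontr)
      fix x y assume xy: "x \<in> F" "y \<in> F" "x \<noteq> y" and "cball x (\<delta> / 4) \<inter> cball y (\<delta> / 4) \<noteq> {}"
      then obtain z where "dist x z \<le> \<delta> / 4" "dist y z \<le> \<delta> / 4" by auto
      then have "dist x y \<le> \<delta> / 2" using dist_triangle2[of x y z] by linarith
      moreover have "\<delta> / 2 < dist x y" using F(3) xy by (auto simp: pairwise_def)
      ultimately show False by simp
    qed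
    then have "measure lebesgue (\<Union>x\<in>F. cball x (\<delta> / 4)) = (\<Sum>x\<in>F. measure lebesgue (cball x (\<delta> / 4)))"
      using F(1) by (intro measure_finite_Union) (use emeasure_lborel_cball_finite in \<open>auto simp: less_le\<close>)
    also have "\<dots> = card F * v" using \<delta> by (simp add: v_def content_cball)
    finally have "card F * v = measure lebesgue (\<Union>x\<in>F. cball x (\<delta> / 4))" ..
    also have "\<dots> \<le> measure lebesgue W"
      using F sub W by (intro measure_mono_fmeasurable) (auto intro!: sets.finite_UN)
    finally show ?thesis using v by (simp add: field_simps)
  qed
  have sep_empty: "sep {}" by (simp add: sep_def)
  obtain N :: nat where N: "measure lebesgue W / v \<le> N" using real_arch_simple by blast
  have bound: "\<forall>F. sep F \<longrightarrow> card F < Suc N"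
    using order_trans[OF card N] by (simp add: less_Suc_eq_le)
  obtain F where F: "sep F" and max: "\<And>G. sep G \<Longrightarrow> card G \<le> card F"
    using ex_has_greatest_nat[OF sep_empty bound] by (elim exE conjE) simp
  have "Z \<subseteq> (\<Union>x\<in>F. cball x (\<delta> / 2))"
  proof (rule ccontr)
    assume "\<not> Z \<subseteq> (\<Union>x\<in>F. cball x (\<delta> / 2))"
    then obtain z where z: "z \<in> Z" "\<And>x. x \<in> F \<Longrightarrow> \<delta> / 2 < dist x z"
      by (auto simp: not_le subset_iff)
    then have "sep (insert z F)"
      using F by (auto simp: sep_def pairwise_insert dist_commute)
    moreover have "z \<notin> F" using z(2)[of z] \<delta> by auto
    ultimately show False using max[of "insert z F"] F by (auto simp: sep_def)
  qed
  then have "covering_number \<delta> Z \<le> ennreal (card F)"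
    using F \<delta> by (intro covering_number_le_card) (auto simp: sep_def)
  also have "\<dots> \<le> ennreal (measure lebesgue W / v)"
    using card[OF F] by (rule ennreal_leI)
  finally show ?thesis by (simp add: v_def)
qed

lemma power_diff_le:
  fixes x y B :: real
  assumes "0 \<le> y" "y \<le> x" "x \<le> B"
  shows "x ^ n - y ^ n \<le> (x - y) * (n * B ^ (n - 1))"
proof -
  have "x ^ n - y ^ n = (x - y) * (\<Sum>i<n. y ^ (n - Suc i) * x ^ i)"
    by (rule power_diff_sumr2)
  also have "\<dots> \<le> (x - y) * (\<Sum>i<n. B ^ (n - 1))"
  proof (intro mult_left_mono sum_mono)
    fix i assume "i \<in> {..<n}"
    have "y ^ (n - Suc i) * x ^ i \<le> B ^ (n - Suc i) * B ^ i"
      using assms by (intro mult_mono power_mono) auto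
    also have "\<dots> = B ^ (n - 1)"
      using \<open>i \<in> {..<n}\<close> by (simp add: power_add[symmetric])
    finally show "y ^ (n - Suc i) * x ^ i \<le> B ^ (n - 1)" .
  qed (use assms in auto)
  finally show ?thesis by simp
qed

lemma measure_spherical_shell_le:
  fixes p :: "'a::euclidean_space" and a R B :: real
  assumes "0 \<le> a" "a \<le> R" "R + a \<le> B"
  shows "measure lebesgue (cball p (R + a) - ball p (R - a))
    \<le> unit_ball_vol DIM('a) * (2 * a * (DIM('a) * B ^ (DIM('a) - 1)))"
proof -
  have "measure lebesgue (cball p (R + a) - ball p (R - a))
      = measure lebesgue (cball p (R + a)) - measure lebesgue (ball p (R - a))"
    using assms by (intro measurable_measure_Diff) auto
  also have "\<dots> = unit_ball_vol DIM('a) * ((R + a) ^ DIM('a) - (R - a) ^ DIM('a))"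
    using assms by (simp add: content_cball content_ball right_diff_distrib)
  also have "\<dots> \<le> unit_ball_vol DIM('a) * (((R + a) - (R - a)) * (DIM('a) * B ^ (DIM('a) - 1)))"
    using assms by (intro mult_left_mono power_diff_le) auto
  finally show ?thesis by simp
qed

text \<open>Widening the shells to half-width \<open>3 * \<delta>\<close> absorbs the balls of
  radius \<open>\<delta> / 4\<close>. A widened shell has volume of order \<open>\<delta>\<close>;
  dividing by the volume of a small ball leaves the exponent \<open>1 - DIM('a)\<close>.\<close>

lemma covering_number_spherical_shells_le:
  fixes p :: "'i \<Rightarrow> 'a::euclidean_space" and R :: "'i \<Rightarrow> real" and B :: real
  assumes "finite J" "\<delta> > 0" and R: "\<And>j. j \<in> J \<Longrightarrow> 3 * \<delta> \<le> R j" "\<And>j. j \<in> J \<Longrightarrow> R j + 3 * \<delta> \<le> B"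
    and Z: "Z \<subseteq> (\<Union>j\<in>J. {x. \<bar>dist (p j) x - R j\<bar> \<le> 2 * \<delta>})"
  shows "covering_number \<delta> Z
    \<le> ennreal (card J * (6 * DIM('a) * B ^ (DIM('a) - 1) * 4 ^ DIM('a)) * (\<delta> powr (1 - real DIM('a))))"
proof -
  define W where "W = (\<Union>j\<in>J. cball (p j) (R j + 3 * \<delta>) - ball (p j) (R j - 3 * \<delta>))"
  have W: "W \<in> lmeasurable" unfolding W_def using assms(1) by (intro fmeasurable.finite_UN fmeasurable.Diff) auto
  have "cball z (\<delta> / 4) \<subseteq> W" if zZ: "z \<in> Z" for z
  proof
    fix x assume x: "x \<in> cball z (\<delta> / 4)"
    obtain j where j: "j \<in> J" "\<bar>dist (p j) z - R j\<bar> \<le> 2 * \<delta>" using Z zZ by blast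
    have "\<bar>dist (p j) x - dist (p j) z\<bar> \<le> \<delta> / 4"
      using x abs_dist_diff_le[of z "p j" x] by (simp add: dist_commute abs_minus_commute)
    then have "x \<in> cball (p j) (R j + 3 * \<delta>) - ball (p j) (R j - 3 * \<delta>)"
      using j(2) \<open>\<delta> > 0\<close> unfolding Diff_iff mem_cball mem_ball by linarith
    then show "x \<in> W" unfolding W_def using j(1) by blast
  qed
  then have "covering_number \<delta> Z \<le> ennreal (measure lebesgue W / (unit_ball_vol DIM('a) * (\<delta> / 4) ^ DIM('a)))"
    by (rule covering_number_le_volume[OF assms(2) W])
  also have "measure lebesgue W / (unit_ball_vol DIM('a) * (\<delta> / 4) ^ DIM('a))
      \<le> card J * (6 * DIM('a) * B ^ (DIM('a) - 1) * 4 ^ DIM('a)) * (\<delta> powr (1 - real DIM('a)))"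
  proof -
    have "measure lebesgue W \<le> (\<Sum>j\<in>J. measure lebesgue (cball (p j) (R j + 3 * \<delta>) - ball (p j) (R j - 3 * \<delta>)))"
      unfolding W_def using assms(1) by (intro measure_UNION_le) auto
    also have "\<dots> \<le> (\<Sum>j\<in>J. unit_ball_vol DIM('a) * (2 * (3 * \<delta>) * (DIM('a) * B ^ (DIM('a) - 1))))"
      using R \<open>\<delta> > 0\<close> by (intro sum_mono measure_spherical_shell_le) auto
    also have "\<dots> = card J * (unit_ball_vol DIM('a) * (2 * (3 * \<delta>) * (DIM('a) * B ^ (DIM('a) - 1))))"
      by simp
    finally have "measure lebesgue W / (unit_ball_vol DIM('a) * (\<delta> / 4) ^ DIM('a)) \<le>
      card J * (unit_ball_vol DIM('a) * (2 * (3 * \<delta>) * (DIM('a) * B ^ (DIM('a) - 1)))) /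
        (unit_ball_vol DIM('a) * (\<delta> / 4) ^ DIM('a))"
      using \<open>\<delta> > 0\<close> by (intro divide_right_mono) auto
    also have "\<dots> = card J * (6 * DIM('a) * B ^ (DIM('a) - 1) * 4 ^ DIM('a)) * (\<delta> / \<delta> ^ DIM('a))"
    proof -
      have "c * (u * (2 * (3 * d) * (n * x))) / (u * (d / 4) ^ n) = c * (6 * n * x * 4 ^ n) * (d / d ^ n)"
        if "u \<noteq> 0" for c u d x :: real and n :: nat
        using that by (simp add: power_divide)
      moreover have "unit_ball_vol (real DIM('a)) \<noteq> 0" using unit_ball_vol_pos[of "real DIM('a)"] by linarith
      ultimately show ?thesis by blast
    qed
    also have "\<delta> / \<delta> ^ DIM('a) = \<delta> powr (1 - real DIM('a))"
      using \<open>\<delta> > 0\<close> by (simp add: powr_diff powr_realpow)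
    finally show ?thesis .
  qed
  finally show ?thesis by (simp add: ennreal_leI)
qed

section \<open>Functions that are flat off a porous set\<close>

lemma infdist_finite_attained:
  fixes A :: "'a::heine_borel set"
  assumes "finite A" "A \<noteq> {}"
  shows "\<exists>a\<in>A. infdist x A = dist x a"
  using infdist_attains_inf[of A x] assms by (metis finite_imp_closed)

text \<open>
  The hole is a ball of radius almost \<open>t\<close> touching the shell from inside, on the segment from \<open>x\<close> to
  its nearest centre. Later shells lie further out since the sets \<open>A k\<close> grow, and earlier ones are
  kept away by the gap \<open>4 * t\<close> between radii.
\<close>

lemma infdist_shells_have_holes:
  fixes A :: "nat \<Rightarrow> 'a::euclidean_space set" and R :: "nat \<Rightarrow> real"
  assumes A: "\<And>k. finite (A k)" "\<And>k. A k \<noteq> {}" "\<And>k l. k \<le> l \<Longrightarrow> A k \<subseteq> A l"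
    and R: "\<And>k. 2 * t \<le> R k" "\<And>k l. k < l \<Longrightarrow> R k + 4 * t \<le> R l"
    and \<eta>: "0 < \<eta>" "\<eta> \<le> 1" and w: "0 < w" "4 * w < \<eta> * t"
    and x: "\<bar>infdist x (A k) - R k\<bar> \<le> 2 * w"
  shows "\<exists>y\<in>cball x t. \<forall>z\<in>cball y (t * (1 - \<eta>)). \<forall>l. 2 * w < \<bar>infdist z (A l) - R l\<bar>"
proof -
  have "0 < \<eta> * t" using w by linarith
  then have "t > 0" using \<eta> by (simp add: zero_less_mult_iff)
  have "\<eta> * t \<le> 1 * t" using \<eta> \<open>t > 0\<close> by (intro mult_right_mono) auto
  then have wt: "4 * w < t" using w by simp
  obtain p where p: "p \<in> A k" "infdist x (A k) = dist x p"
    using infdist_finite_attained[OF A(1,2)] by blast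
  define L where "L = dist x p"
  have L: "\<bar>L - R k\<bar> \<le> 2 * w" using x p by (simp add: L_def)
  have "t \<le> L" using L R(1)[of k] wt by linarith
  define y where "y = x + (t / L) *\<^sub>R (p - x)"
  have "p - y = (1 - t / L) *\<^sub>R (p - x)" by (simp add: y_def algebra_simps)
  then have "dist p y = \<bar>1 - t / L\<bar> * L" by (simp add: dist_norm L_def norm_minus_commute)
  also have "\<dots> = L - t" using \<open>t \<le> L\<close> \<open>t > 0\<close> by (simp add: field_simps)
  finally have py: "dist p y = L - t" .
  have "dist x y = \<bar>t / L\<bar> * L" by (simp add: y_def dist_norm L_def norm_minus_commute)
  also have "\<dots> = t" using \<open>t \<le> L\<close> \<open>t > 0\<close> by simp
  finally have xy: "dist x y = t" .
  have "2 * w < \<bar>infdist z (A l) - R l\<bar>" if z: "z \<in> cball y (t * (1 - \<eta>))" for z l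
  proof -
    have yz: "dist y z \<le> t - \<eta> * t" using z by (simp add: algebra_simps)
    show ?thesis
    proof (cases "k \<le> l")
      case True
      have "infdist z (A l) \<le> dist z p" using A(3)[OF True] p by (intro infdist_le) auto
      also have "\<dots> \<le> dist p y + dist y z" using dist_triangle[of p z y] by (simp add: dist_commute)
      finally have "infdist z (A l) \<le> L - \<eta> * t" using py yz by linarith
      moreover have "R k \<le> R l" using True R(2)[of k l] \<open>t > 0\<close> by (cases "k = l") auto
      \<comment> \<open>Since \<open>L \<le> R k + 2 * w\<close>, the loss
        \<open>\<eta> * t > 4 * w\<close> takes the distance below
        \<open>R l - 2 * w\<close>.\<close>
      ultimately show ?thesis using L w by linarith
    next
      case False
      \<comment> \<open>The smaller set \<open>A l\<close> is at least as far from \<open>x\<close>;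
        moving to \<open>z\<close> loses less than \<open>2 * t\<close> of the gap
        \<open>4 * t\<close>.\<close>
      then have "infdist x (A k) \<le> infdist x (A l)" using A by (intro infdist_mono) auto
      also have "\<dots> \<le> infdist z (A l) + dist x z" by (rule infdist_triangle)
      finally have "L \<le> infdist z (A l) + dist x z" using p by (simp add: L_def)
      moreover have "dist x z \<le> t + (t - \<eta> * t)" using dist_triangle[of x z y] xy yz by linarith
      moreover have "R l + 4 * t \<le> R k" using R(2)[of l k] False by simp
      ultimately show ?thesis using L w \<open>0 < \<eta> * t\<close> wt by linarith
    qed
  qed
  then show ?thesis using xy by (intro bexI[of _ y]) auto
qed

text \<open>The flatness, hole and covering clauses may hold at three different scales. Taking
  \<open>c\<close> strictly below \<open>\<eta> * w\<close> leaves room for perturbing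
  \<open>f\<close>.\<close>

definition flat_off_porous_set :: "real \<Rightarrow> (real ^ 'n \<Rightarrow> real) \<Rightarrow> (real ^ 'n) set \<Rightarrow> bool" where
  "flat_off_porous_set \<eta> f Z \<longleftrightarrow>
     (\<exists>w>0. w < \<eta> \<and> (\<exists>c<\<eta> * w. \<forall>x\<in>cbox 0 1 - Z.
        \<forall>y\<in>cbox 0 1 \<inter> cball x w. \<forall>z\<in>cbox 0 1 \<inter> cball x w. \<bar>f y - f z\<bar> \<le> c)) \<and>
     (\<exists>t>0. t < \<eta> \<and> (\<forall>x\<in>Z. \<exists>y\<in>cball x t. cball y (t * (1 - \<eta>)) \<inter> Z = {})) \<and>
     (\<exists>\<delta>>0. \<delta> < \<eta> \<and> covering_number \<delta> Z * ennreal (\<delta> powr (real (CARD('n) - 1) + \<eta>)) \<le> ennreal \<eta>)"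

text \<open>Only the flatness clause involves \<open>f\<close>. With \<open>e\<close> a quarter of
  its slack, differences change by at most half of the slack.\<close>

lemma flat_off_porous_set_stable:
  fixes f :: "real ^ 'n \<Rightarrow> real"
  assumes "flat_off_porous_set \<eta> f Z"
  shows "\<exists>e>0. \<forall>g. (\<forall>x\<in>cbox 0 1. \<bar>f x - g x\<bar> \<le> e) \<longrightarrow> flat_off_porous_set \<eta> g Z"
proof -
  obtain w c where w: "0 < w" "w < \<eta>" "c < \<eta> * w"
    and c: "\<And>x y z. x \<in> cbox 0 1 - Z \<Longrightarrow> y \<in> cbox 0 1 \<inter> cball x w \<Longrightarrow> z \<in> cbox 0 1 \<inter> cball x w \<Longrightarrow>
      \<bar>f y - f z\<bar> \<le> c"
    using assms unfolding flat_off_porous_set_def by blast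
  define e where "e = (\<eta> * w - c) / 4"
  have e: "e > 0" using w by (simp add: e_def)
  have "flat_off_porous_set \<eta> g Z" if g: "\<forall>x\<in>cbox 0 1. \<bar>f x - g x\<bar> \<le> e" for g
  proof -
    have "c + 2 * e < \<eta> * w" using w(3) by (simp add: e_def field_simps)
    moreover have "\<bar>g y - g z\<bar> \<le> c + 2 * e"
      if x: "x \<in> cbox 0 1 - Z" and y: "y \<in> cbox 0 1 \<inter> cball x w" and z: "z \<in> cbox 0 1 \<inter> cball x w" for x y z
    proof -
      have "\<bar>f y - g y\<bar> \<le> e" "\<bar>f z - g z\<bar> \<le> e" using g y z by auto
      then show ?thesis using c[OF x y z] by linarith
    qed
    ultimately have "\<exists>w>0. w < \<eta> \<and> (\<exists>c<\<eta> * w. \<forall>x\<in>cbox 0 1 - Z.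
        \<forall>y\<in>cbox 0 1 \<inter> cball x w. \<forall>z\<in>cbox 0 1 \<inter> cball x w. \<bar>g y - g z\<bar> \<le> c)"
      using w(1,2) by blast
    with assms show ?thesis unfolding flat_off_porous_set_def by blast
  qed
  with e show ?thesis by blast
qed

lemma exists_small_powr:
  fixes a C \<eta> :: real
  assumes "0 < a" "0 < C" "0 < \<eta>"
  shows "\<exists>\<delta>>0. \<delta> < a \<and> C * \<delta> powr \<eta> \<le> \<eta>"
proof -
  define \<delta> where "\<delta> = min (a / 2) ((\<eta> / C) powr (1 / \<eta>))"
  have \<delta>: "0 < \<delta>" "\<delta> < a" using assms by (auto simp: \<delta>_def)
  have "\<delta> powr \<eta> \<le> ((\<eta> / C) powr (1 / \<eta>)) powr \<eta>"
    using assms \<delta> by (intro powr_mono2) (auto simp: \<delta>_def)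
  also have "\<dots> = \<eta> / C" using assms by (simp add: powr_powr)
  finally show ?thesis using assms \<delta> by (intro exI[of _ \<delta>]) (auto simp: field_simps)
qed

text \<open>The net, the levels and the radii are fixed first, the shell width \<open>w\<close>
  last. The covering constant \<open>C\<close> is then independent of \<open>w\<close>, and a small
  \<open>w\<close> gives \<open>C * w powr \<eta> \<le> \<eta>\<close>.\<close>

lemma flat_off_porous_set_dense:
  fixes f :: "real ^ 'n \<Rightarrow> real"
  assumes f: "continuous_on (cbox 0 1) f" and e: "e > 0" and \<eta>: "0 < \<eta>" "\<eta> \<le> 1"
  shows "\<exists>g Z. continuous_on (cbox 0 1) g \<and> (\<forall>x\<in>cbox 0 1. \<bar>f x - g x\<bar> \<le> e) \<and> flat_off_porous_set \<eta> g Z"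
proof -
  define e1 where "e1 = e / 2"
  have e1: "e1 > 0" using e by (simp add: e1_def)
  have "uniformly_continuous_on (cbox 0 1) f"
    using f by (intro compact_uniformly_continuous) auto
  then obtain d where d: "d > 0" "\<And>x y. x \<in> cbox 0 1 \<Longrightarrow> y \<in> cbox 0 1 \<Longrightarrow> dist y x < d \<Longrightarrow> dist (f y) (f x) < e1"
    using e1 unfolding uniformly_continuous_on_def by meson
  \<comment> \<open>All shells lie within \<open>3 * \<rho>\<close> of their centres, a distance
    over which \<open>f\<close> varies by less than \<open>e1\<close>.\<close>
  define \<rho> where "\<rho> = min (d / 4) (\<eta> / 2)"
  have \<rho>: "0 < \<rho>" "3 * \<rho> < d" "\<rho> < \<eta>" using d \<eta> by (auto simp: \<rho>_def min_def)
  have near: "\<bar>f x - f y\<bar> < e1" if "x \<in> cbox 0 1" "y \<in> cbox 0 1" "dist x y \<le> 3 * \<rho>" for x y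
    using d(2)[of y x] that \<rho> by (simp add: dist_real_def)
  have "seq_compact (cbox (0 :: real ^ 'n) 1)"
    using compact_cbox compact_eq_seq_compact_metric by blast
  from seq_compact_imp_totally_bounded[OF this, rule_format, OF \<rho>(1)]
  obtain N where N: "finite N" "N \<subseteq> cbox (0 :: real ^ 'n) 1" "cbox 0 1 \<subseteq> (\<Union>p\<in>N. ball p \<rho>)"
    by blast
  have "N \<noteq> {}" using N(3) cube_nonempty[where 'n = 'n] by auto
  \<comment> \<open>Starting at the minimum over the net keeps every \<open>A k\<close>
    nonempty.\<close>
  define v where "v = (\<lambda>k::nat. Min (f ` N) + k * e1)"
  have v_mono: "v k \<le> v l" if "k \<le> l" for k l using that e1 by (simp add: v_def)
  obtain m0 :: nat where m0: "(Max (f ` N) - Min (f ` N)) / e1 \<le> m0" using real_arch_simple by blast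
  \<comment> \<open>The successor makes \<open>m\<close> positive, as needed for the division in
    \<open>t\<close> and for \<open>J\<close> to be nonempty.\<close>
  define m where "m = Suc m0"
  have v_m: "f p \<le> v m" if "p \<in> N" for p
  proof -
    have "f p \<le> Max (f ` N)" using N(1) that by simp
    also have "\<dots> \<le> v m0" using m0 e1 by (simp add: v_def field_simps)
    also have "\<dots> \<le> v m" by (rule v_mono) (simp add: m_def)
    finally show ?thesis .
  qed
  define A where "A = (\<lambda>k. {p \<in> N. f p \<le> v k})"
  have "Min (f ` N) \<in> f ` N" using N(1) \<open>N \<noteq> {}\<close> by (intro Min_in) auto
  then obtain p0 where "p0 \<in> N" "f p0 = Min (f ` N)" by auto
  then have "p0 \<in> A k" for k using e1 by (simp add: A_def v_def)
  then have A_ne: "A k \<noteq> {}" for k by blast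
  have A_fin: "finite (A k)" for k using N(1) by (simp add: A_def)
  have A_mono: "A k \<subseteq> A l" if "k \<le> l" for k l using v_mono[OF that] by (auto simp: A_def)
  \<comment> \<open>With gaps \<open>4 * t\<close> the radii \<open>R 0\<close> to
    \<open>R m\<close> run exactly from \<open>\<rho>\<close> to \<open>2 * \<rho>\<close>.\<close>
  define t where "t = \<rho> / (4 * m)"
  have t: "t > 0" "4 * m * t = \<rho>" "4 * t \<le> \<rho>"
    using \<rho>(1) by (simp_all add: t_def m_def field_simps)
  define R where "R = (\<lambda>k::nat. \<rho> + k * (4 * t))"
  have R_le: "R k \<le> 2 * \<rho>" if "k \<le> m" for k
  proof -
    have "k * (4 * t) \<le> m * (4 * t)" using that t by (intro mult_right_mono) auto
    also have "\<dots> = \<rho>" using t(2) by simp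
    finally show ?thesis by (simp add: R_def)
  qed
  have R_ge: "\<rho> \<le> R k" for k using t by (simp add: R_def)
  have R_gap: "R k + 4 * t \<le> R l" if "k < l" for k l
  proof -
    have "real (k + 1) * (4 * t) \<le> real l * (4 * t)" using that t by (intro mult_right_mono) auto
    moreover have "real (k + 1) * (4 * t) = real k * (4 * t) + 4 * t" by (simp add: algebra_simps)
    ultimately show ?thesis unfolding R_def by linarith
  qed
  define q where "q = (\<lambda>k x. infdist x (A k))"
  define J where "J = {..<m} \<times> N"
  define C where "C = card J * (6 * DIM(real ^ 'n) * (3 * \<rho>) ^ (DIM(real ^ 'n) - 1) * 4 ^ DIM(real ^ 'n))"
  have "J \<noteq> {}" "finite J" using N(1) \<open>N \<noteq> {}\<close> by (auto simp: J_def m_def)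
  then have "card J > 0" by (simp add: card_gt_0_iff)
  then have "C > 0" using \<rho>(1) unfolding C_def by (intro mult_pos_pos) auto
  \<comment> \<open>The bounds serve, in order, the smallness of the scales, the holes, and the
    inner and outer radii of the shells.\<close>
  define a where "a = min \<eta> (min (\<eta> * t / 4) (\<rho> / 3))"
  have "a > 0" using \<eta> t \<rho> by (simp add: a_def)
  then obtain w where w: "w > 0" "w < a" "C * w powr \<eta> \<le> \<eta>"
    using exists_small_powr \<open>C > 0\<close> \<eta>(1) by blast
  have w': "w < \<eta>" "4 * w < \<eta> * t" "3 * w < \<rho>" using w(2) by (simp_all add: a_def)
  \<comment> \<open>\<open>g\<close> climbs by \<open>e1\<close> across each shell: it is at most \<open>v k\<close> within \<open>R k\<close> of a net point where
     \<open>f \<le> v k\<close>. The increasing radii keep the shells of different levels apart.\<close>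
  define c where "c = (\<lambda>k x. max 0 (min 1 ((q k x - R k) / w)))"
  define g where "g = (\<lambda>x. v 0 + (\<Sum>k<m. e1 * c k x))"
  define Z where "Z = {x. \<exists>k<m. \<bar>q k x - R k\<bar> \<le> 2 * w}"
  have "continuous_on (cbox 0 1) g"
    unfolding g_def c_def q_def using w by (intro continuous_intros) auto
  moreover have "\<bar>f x - g x\<bar> \<le> e" if x: "x \<in> cbox 0 1" for x
  proof -
    obtain p where p: "p \<in> N" "dist p x < \<rho>" using N(3) x by auto
    then have fp: "\<bar>f x - f p\<bar> < e1" using near[of x p] N(2) x \<rho>(1) by (auto simp: dist_commute)
    \<comment> \<open>Upper estimate: \<open>p\<close> lies in \<open>A k\<close> for all
      \<open>k \<ge> i\<close> and is within \<open>\<rho>\<close> of \<open>x\<close>, so no step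
      from \<open>i\<close> on has begun at \<open>x\<close>.\<close>
    define i where "i = (LEAST k. f p \<le> v k)"
    have i: "f p \<le> v i" unfolding i_def by (rule LeastI[of _ m]) (rule v_m[OF p(1)])
    have "i \<le> m" unfolding i_def by (rule Least_le) (rule v_m[OF p(1)])
    have v_i: "v i \<le> f p + e1"
    proof (cases i)
      case 0
      then show ?thesis using N(1) p(1) e1 by (simp add: v_def add_increasing2)
    next
      case (Suc k)
      then have "k < (LEAST k. f p \<le> v k)" unfolding i_def by simp
      then have "\<not> f p \<le> v k" by (rule not_less_Least)
      then show ?thesis using Suc by (simp add: v_def algebra_simps)
    qed
    have c0: "c k x = 0" if "i \<le> k" for k
    proof -
      have "p \<in> A k" using i v_mono[OF that] p(1) by (simp add: A_def)
      then have "q k x \<le> dist x p" unfolding q_def by (rule infdist_le)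
      then have "q k x - R k \<le> 0" using p(2) R_ge[of k] by (simp add: dist_commute)
      then have "(q k x - R k) / w \<le> 0" using w(1) by (simp add: divide_nonpos_pos)
      then show ?thesis by (simp add: c_def)
    qed
    have "(\<Sum>k<m. e1 * c k x) \<le> (\<Sum>k<m. if k < i then e1 else 0)"
      using c0 e1 by (intro sum_mono) (auto simp: c_def not_less)
    also have "\<dots> = i * e1"
    proof -
      have "{..<m} \<inter> {k. k < i} = {..<i}" using \<open>i \<le> m\<close> by auto
      then show ?thesis by (simp add: sum.If_cases)
    qed
    finally have upper: "g x \<le> v i" by (simp add: g_def v_def)
    \<comment> \<open>Lower estimate: \<open>s\<close> is the first step not completed at
      \<open>x\<close>, or \<open>m\<close> if there is none. An incomplete step means that a net
      point of \<open>A s\<close> is within \<open>3 * \<rho>\<close>.\<close>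
    define s where "s = (LEAST k. k = m \<or> c k x < 1)"
    have s: "s = m \<or> c s x < 1" unfolding s_def by (rule LeastI[of _ m]) simp
    have "s \<le> m" unfolding s_def by (rule Least_le) simp
    have "s * e1 = (\<Sum>k<s. e1)" by simp
    also have "\<dots> \<le> (\<Sum>k<s. e1 * c k x)"
    proof (rule sum_mono)
      fix k assume "k \<in> {..<s}"
      then have "\<not> (k = m \<or> c k x < 1)" unfolding s_def by (intro not_less_Least) simp
      then show "e1 \<le> e1 * c k x" using e1 by simp
    qed
    also have "\<dots> \<le> (\<Sum>k<m. e1 * c k x)"
      using \<open>s \<le> m\<close> e1 by (intro sum_mono2) (auto simp: c_def)
    finally have lower: "v s \<le> g x" by (simp add: g_def v_def)
    have "f x - e1 \<le> v s"
    proof (cases "s = m")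
      case True
      then show ?thesis using v_m[OF p(1)] fp by simp
    next
      case False
      then have "c s x < 1" using s by simp
      then have "(q s x - R s) / w < 1" unfolding c_def by (simp add: max_def min_def split: if_splits)
      then have "q s x < R s + w" using w(1) by (simp add: field_simps)
      obtain p' where p': "p' \<in> A s" "q s x = dist x p'"
        unfolding q_def using infdist_finite_attained[OF A_fin A_ne] by blast
      have "dist x p' \<le> 3 * \<rho>"
        using \<open>q s x < R s + w\<close> p'(2) R_le[OF \<open>s \<le> m\<close>] w' w(1) \<rho>(1) by linarith
      moreover have "p' \<in> cbox 0 1" using p'(1) N(2) by (auto simp: A_def)
      ultimately have "\<bar>f x - f p'\<bar> < e1" using near x by blast
      moreover have "f p' \<le> v s" using p'(1) by (simp add: A_def)
      ultimately show ?thesis by linarith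
    qed
    then have "f x - g x \<le> e1" "g x - f x \<le> 2 * e1" using upper lower v_i fp e1 by linarith+
    then show ?thesis using e by (simp add: e1_def abs_le_iff)
  qed
  moreover have "flat_off_porous_set \<eta> g Z"
    unfolding flat_off_porous_set_def
  proof (intro conjI)
    \<comment> \<open>The ramp of \<open>c k\<close> occupies \<open>R k\<close> to
      \<open>R k + w\<close>. A point off \<open>Z\<close> is more than \<open>2 * w\<close> from
      radius \<open>R k\<close>, so its \<open>w\<close>-ball stays on one side of the ramp.\<close>
    have const: "c k y = c k x" if x: "x \<notin> Z" and k: "k < m" and y: "y \<in> cball x w" for x y k
    proof -
      have far: "2 * w < \<bar>q k x - R k\<bar>" using x k by (auto simp: Z_def not_le)
      have "\<bar>q k x - q k y\<bar> \<le> w"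
        using y infdist_triangle[of x "A k" y] infdist_triangle[of y "A k" x] by (simp add: q_def dist_commute abs_le_iff)
      then consider "w < q k x - R k" "w < q k y - R k" | "q k x - R k < 0" "q k y - R k < 0"
        using far w(1) by linarith
      then show ?thesis
      proof cases
        case 1
        then have "1 \<le> (q k x - R k) / w" "1 \<le> (q k y - R k) / w" using w(1) by simp_all
        then show ?thesis by (simp add: c_def)
      next
        case 2
        then have "(q k x - R k) / w \<le> 0" "(q k y - R k) / w \<le> 0"
          using w(1) by (simp_all add: divide_nonpos_pos)
        then show ?thesis by (simp add: c_def)
      qed
    qed
    have "g y = g x" if "x \<notin> Z" "y \<in> cball x w" for x y
      unfolding g_def using const[OF that(1) _ that(2)] by simp
    then have "\<forall>x\<in>cbox 0 1 - Z. \<forall>y\<in>cbox 0 1 \<inter> cball x w. \<forall>z\<in>cbox 0 1 \<inter> cball x w. \<bar>g y - g z\<bar> \<le> 0"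
      by auto
    moreover have "0 < \<eta> * w" using \<eta> w by simp
    ultimately show "\<exists>w>0. w < \<eta> \<and> (\<exists>c<\<eta> * w. \<forall>x\<in>cbox 0 1 - Z.
        \<forall>y\<in>cbox 0 1 \<inter> cball x w. \<forall>z\<in>cbox 0 1 \<inter> cball x w. \<bar>g y - g z\<bar> \<le> c)"
      using w(1) w'(1) by blast
  next
    have "\<exists>y\<in>cball x t. cball y (t * (1 - \<eta>)) \<inter> Z = {}" if xZ: "x \<in> Z" for x
    proof -
      obtain k where k: "\<bar>infdist x (A k) - R k\<bar> \<le> 2 * w" using xZ by (auto simp: Z_def q_def)
      have "2 * t \<le> R k" for k using R_ge[of k] t by linarith
      from infdist_shells_have_holes[where A = A and R = R, OF A_fin A_ne A_mono this R_gap \<eta> w(1) w'(2) k]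
      obtain y where "y \<in> cball x t" "\<forall>z\<in>cball y (t * (1 - \<eta>)). \<forall>l. 2 * w < \<bar>infdist z (A l) - R l\<bar>"
        by blast
      then show ?thesis
        by (intro bexI[of _ y]) (auto simp: Z_def q_def disjoint_iff not_le)
    qed
    moreover have "t < \<eta>" using t \<rho> by linarith
    ultimately show "\<exists>t>0. t < \<eta> \<and> (\<forall>x\<in>Z. \<exists>y\<in>cball x t. cball y (t * (1 - \<eta>)) \<inter> Z = {})"
      using t(1) by blast
  next
    \<comment> \<open>Distance to a finite set is attained, so \<open>Z\<close> splits into shells
      about single net points, indexed by level and centre.\<close>
    have "Z \<subseteq> (\<Union>j\<in>J. {x. \<bar>dist (snd j) x - R (fst j)\<bar> \<le> 2 * w})"
    proof
      fix x assume "x \<in> Z"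
      then obtain k where k: "k < m" "\<bar>infdist x (A k) - R k\<bar> \<le> 2 * w" by (auto simp: Z_def q_def)
      obtain p where p: "p \<in> A k" "infdist x (A k) = dist x p"
        using infdist_finite_attained[OF A_fin A_ne] by blast
      then have "(k, p) \<in> J" using k by (simp add: J_def A_def)
      then show "x \<in> (\<Union>j\<in>J. {x. \<bar>dist (snd j) x - R (fst j)\<bar> \<le> 2 * w})"
        using k p by (intro UN_I[of "(k, p)"]) (auto simp: dist_commute)
    qed
    moreover have "3 * w \<le> R (fst j)" "R (fst j) + 3 * w \<le> 3 * \<rho>" if "j \<in> J" for j
      using R_ge[of "fst j"] R_le[of "fst j"] w'(3) that by (auto simp: J_def)
    ultimately have "covering_number w Z \<le> ennreal (C * (w powr (1 - real DIM(real ^ 'n))))"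
      unfolding C_def using \<open>finite J\<close> w(1) by (intro covering_number_spherical_shells_le)
    then have "covering_number w Z * ennreal (w powr (real (CARD('n) - 1) + \<eta>))
        \<le> ennreal (C * (w powr (1 - real DIM(real ^ 'n)))) * ennreal (w powr (real (CARD('n) - 1) + \<eta>))"
      by (rule mult_right_mono) simp
    also have "\<dots> = ennreal (C * (w powr (1 - real DIM(real ^ 'n)) * w powr (real (CARD('n) - 1) + \<eta>)))"
      using \<open>C > 0\<close> by (simp add: ennreal_mult[symmetric] mult.assoc)
    also have "w powr (1 - real DIM(real ^ 'n)) * w powr (real (CARD('n) - 1) + \<eta>) = w powr \<eta>"
      by (simp add: powr_add[symmetric])
    also have "ennreal (C * w powr \<eta>) \<le> ennreal \<eta>" using w(3) by (rule ennreal_leI)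
    finally show "\<exists>\<delta>>0. \<delta> < \<eta> \<and>
        covering_number \<delta> Z * ennreal (\<delta> powr (real (CARD('n) - 1) + \<eta>)) \<le> ennreal \<eta>"
      using w(1) w'(1) by blast
  qed
  ultimately show ?thesis by blast
qed

section \<open>Consequences for the set of positive little lip\<close>

lemma positive_little_lip_imp_eventually_mem:
  fixes f :: "real ^ 'n \<Rightarrow> real"
  assumes flat: "\<And>n. flat_off_porous_set (1 / Suc n) f (Z n)"
    and x: "x \<in> cbox 0 1" "little_lip (cbox 0 1) f x > 0"
  shows "\<exists>N. \<forall>n\<ge>N. x \<in> Z n"
proof (rule ccontr)
  assume "\<not> ?thesis"
  then have io: "\<exists>n\<ge>N. x \<notin> Z n" for N by blast
  obtain y where y: "0 < y" "y < little_lip (cbox 0 1) f x" using dense[OF x(2)] by blast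
  then obtain c where c: "y = ennreal c" "0 < c" by (cases y) (auto simp: top_unique)
  have "\<forall>\<^sub>F r in at_right 0. y < ennreal (diameter (f ` (cbox 0 1 \<inter> cball x r)) / r)"
    using y(2) unfolding little_lip_def by (rule less_LiminfD)
  then obtain b where b: "b > 0"
      "\<And>r. 0 < r \<Longrightarrow> r < b \<Longrightarrow> y < ennreal (diameter (f ` (cbox 0 1 \<inter> cball x r)) / r)"
    by (auto simp: eventually_at_right_field)
  have "0 < min b c" using b(1) c(2) by simp
  then obtain N where N: "inverse (real (Suc N)) < min b c" using reals_Archimedean by blast
  \<comment> \<open>Being outside such a \<open>Z n\<close> makes the quotient at radius
    \<open>w < b\<close> smaller than \<open>c\<close>, against the liminf bound.\<close>
  obtain n where n: "n \<ge> N" "x \<notin> Z n" using io by blast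
  have "1 / real (Suc n) \<le> inverse (real (Suc N))" using n(1) by (simp add: field_simps)
  then have small: "1 / real (Suc n) < b" "1 / real (Suc n) < c" using N by linarith+
  obtain w c' where w: "0 < w" "w < 1 / Suc n" "c' < 1 / Suc n * w"
    and flat_n: "\<forall>x\<in>cbox 0 1 - Z n. \<forall>y\<in>cbox 0 1 \<inter> cball x w. \<forall>z\<in>cbox 0 1 \<inter> cball x w. \<bar>f y - f z\<bar> \<le> c'"
    using flat[of n] unfolding flat_off_porous_set_def by blast
  have "diameter (f ` (cbox 0 1 \<inter> cball x w)) \<le> c'"
    using flat_n x(1) n(2) w(1) by (intro diameter_le) auto
  also have "c' \<le> c * w"
  proof -
    have "1 / Suc n * w \<le> c * w" using small(2) w(1) by (intro mult_right_mono) auto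
    then show ?thesis using w(3) by linarith
  qed
  finally have "diameter (f ` (cbox 0 1 \<inter> cball x w)) / w \<le> c"
    using w(1) by (simp add: field_simps)
  then have "ennreal (diameter (f ` (cbox 0 1 \<inter> cball x w)) / w) \<le> y"
    unfolding c by (rule ennreal_leI)
  moreover have "w < b" using w(2) small(1) by linarith
  ultimately show False using b(2)[of w] w(1) by (simp add: leD)
qed

lemma exists_inverse_Suc_le:
  assumes "e > 0"
  shows "\<exists>n\<ge>N. 1 / real (Suc n) \<le> e"
proof -
  obtain n where n: "inverse (real (Suc n)) < e" using reals_Archimedean[OF assms] by blast
  have "1 / real (Suc (max N n)) \<le> inverse (real (Suc n))" by (simp add: field_simps)
  then show ?thesis using n by (intro exI[of _ "max N n"]) auto
qed

text \<open>Holes of \<open>Z n\<close> are holes of any subset, and \<open>P\<close> lies in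
  \<open>Z n\<close> for arbitrarily large \<open>n\<close>, where their relative size tends to
  1.\<close>

lemma strongly_porous_if_eventually_flat:
  fixes f :: "real ^ 'n \<Rightarrow> real"
  assumes flat: "\<And>n. flat_off_porous_set (1 / Suc n) f (Z n)" and P: "\<And>n. n \<ge> N \<Longrightarrow> P \<subseteq> Z n"
  shows "strongly_porous P"
proof (rule strongly_porousI)
  fix x and e :: real assume x: "x \<in> P" and e: "0 < e" "e < 1"
  obtain n where n: "n \<ge> N" "1 / real (Suc n) \<le> e" using exists_inverse_Suc_le[OF e(1)] by blast
  obtain t where t: "0 < t" "t < 1 / Suc n"
      "\<forall>x\<in>Z n. \<exists>y\<in>cball x t. cball y (t * (1 - 1 / Suc n)) \<inter> Z n = {}"
    using flat[of n] unfolding flat_off_porous_set_def by blast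
  then obtain y where y: "y \<in> cball x t" "cball y (t * (1 - 1 / Suc n)) \<inter> Z n = {}"
    using P[OF n(1)] x by blast
  have "t * (1 - e) \<le> t * (1 - 1 / Suc n)" using n(2) t(1) by (intro mult_left_mono) auto
  then have "cball y (t * (1 - e)) \<subseteq> cball y (t * (1 - 1 / Suc n))" by (rule subset_cball)
  then have "cball y (t * (1 - e)) \<inter> P = {}" using y(2) P[OF n(1)] by blast
  moreover have "t < e" using t(2) n(2) by linarith
  ultimately show "\<exists>t. 0 < t \<and> t < e \<and> (\<exists>y\<in>cball x t. cball y (t * (1 - e)) \<inter> P = {})"
    using t(1) y(1) by blast
qed

text \<open>For large \<open>n\<close> the exponent in the covering clause is at most
  \<open>s\<close>; as \<open>\<delta> \<le> 1\<close>, raising it to \<open>s\<close> only lowers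
  the bound.\<close>

lemma lower_packing_premeasure_eq_0_if_eventually_flat:
  fixes f :: "real ^ 'n \<Rightarrow> real"
  assumes flat: "\<And>n. flat_off_porous_set (1 / Suc n) f (Z n)" and P: "\<And>n. n \<ge> N \<Longrightarrow> P \<subseteq> Z n"
    and s: "s > real (CARD('n) - 1)"
  shows "lower_packing_premeasure s P = 0"
proof (rule lower_packing_premeasure_eq_0)
  fix e :: real assume "e > 0"
  then have "0 < min e (s - real (CARD('n) - 1))" using s by simp
  then obtain n where n: "n \<ge> N" "1 / real (Suc n) \<le> min e (s - real (CARD('n) - 1))"
    using exists_inverse_Suc_le by blast
  obtain \<delta> where \<delta>: "0 < \<delta>" "\<delta> < 1 / Suc n"
      "covering_number \<delta> (Z n) * ennreal (\<delta> powr (real (CARD('n) - 1) + 1 / Suc n)) \<le> ennreal (1 / Suc n)"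
    using flat[of n] unfolding flat_off_porous_set_def by blast
  have "1 / real (Suc n) \<le> 1" by simp
  then have "\<delta> \<le> 1" using \<delta>(2) by linarith
  have "real (CARD('n) - 1) + 1 / Suc n \<le> s" using n(2) by linarith
  then have "\<delta> powr s \<le> \<delta> powr (real (CARD('n) - 1) + 1 / Suc n)"
    using \<delta>(1) \<open>\<delta> \<le> 1\<close> by (intro powr_mono') auto
  then have "covering_number \<delta> P * ennreal (\<delta> powr s)
      \<le> covering_number \<delta> (Z n) * ennreal (\<delta> powr (real (CARD('n) - 1) + 1 / Suc n))"
    using P[OF n(1)] by (intro mult_mono covering_number_mono ennreal_leI) auto
  also have "\<dots> \<le> ennreal (1 / Suc n)" by (rule \<delta>(3))
  also have "\<dots> \<le> ennreal e" using n(2) by (intro ennreal_leI) linarith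
  finally show "\<exists>\<delta>>0. \<delta> < e \<and> covering_number \<delta> P * ennreal (\<delta> powr s) \<le> ennreal e"
    using \<delta>(1,2) n(2) by (intro exI[of _ \<delta>]) auto
qed

theorem theorem1p1:
  shows "\<exists>\<F>. comeager_in (mtopology_of (cube_cfunspace :: (real ^ 'd \<Rightarrow> real) metric)) \<F> \<and>
           (\<forall>f\<in>\<F>.
              \<forall>E\<in>{{x \<in> cbox 0 1. little_lip (cbox 0 1) f x > 0},
                  {x \<in> cbox 0 1. little_lip (cbox 0 1) f x = \<infinity>}}.
                sigma_strongly_porous E \<and>
                lower_packing_dim E = of_nat (CARD('d) - 1) \<and>
                hausdorff_dim E = of_nat (CARD('d) - 1))"
proof -
  \<comment> \<open>Any axis serves for the lower bound.\<close>
  fix k :: 'd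
  \<comment> \<open>Even and odd indices interleave the two sequences of conditions into
    one.\<close>
  define P where "P = (\<lambda>n (f :: real ^ 'd \<Rightarrow> real). if even n then steep_windows k (n div 2) f
    else \<exists>Z. flat_off_porous_set (1 / Suc (n div 2)) f Z)"
  define \<F> where "\<F> = {f \<in> mspace (cube_cfunspace :: (real ^ 'd \<Rightarrow> real) metric). \<forall>n. P n f}"
  have comeager: "comeager_in (mtopology_of cube_cfunspace) \<F>"
    unfolding \<F>_def
  proof (rule comeager_in_cube_cfunspace)
    fix n and f :: "real ^ 'd \<Rightarrow> real"
    show "\<exists>e>0. \<forall>g. (\<forall>x\<in>cbox 0 1. \<bar>f x - g x\<bar> \<le> e) \<longrightarrow> P n g" if "P n f"
    proof (cases "even n")
      case True
      then show ?thesis using steep_windows_stable that unfolding P_def by simp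
    next
      case False
      then obtain Z where "flat_off_porous_set (1 / Suc (n div 2)) f Z" using \<open>P n f\<close> unfolding P_def by auto
      from flat_off_porous_set_stable[OF this] show ?thesis using False unfolding P_def by auto
    qed
    show "\<exists>g. continuous_on (cbox 0 1) g \<and> (\<forall>x\<in>cbox 0 1. \<bar>f x - g x\<bar> \<le> e) \<and> P n g"
      if "continuous_on (cbox 0 1) f" "e > 0" for e
    proof (cases "even n")
      case True
      then show ?thesis using steep_windows_dense[OF that] unfolding P_def by simp
    next
      case False
      then show ?thesis
        using flat_off_porous_set_dense[OF that, of "1 / Suc (n div 2)"] unfolding P_def by auto
    qed
  qed
  \<comment> \<open>Both sets in question lie between the smaller and the larger one, so one
    argument treats them: the lower bound uses the first inclusion, the upper bound and porosity the
    second.\<close>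
  have dims: "sigma_strongly_porous E \<and> lower_packing_dim E = of_nat (CARD('d) - 1) \<and>
      hausdorff_dim E = of_nat (CARD('d) - 1)"
    if f: "f \<in> \<F>" and E: "{x \<in> cbox 0 1. little_lip (cbox 0 1) f x = \<infinity>} \<subseteq> E"
      "E \<subseteq> {x \<in> cbox 0 1. little_lip (cbox 0 1) f x > 0}" for f :: "real ^ 'd \<Rightarrow> real" and E
  proof -
    have P: "P n f" for n using f by (simp add: \<F>_def)
    have cont: "continuous_on (cbox 0 1) f" using f unfolding \<F>_def mem_Collect_eq mem_cube_cfunspace by blast
    have steep: "steep_windows k n f" for n using P[of "2 * n"] by (simp add: P_def)
    have "\<exists>Z. flat_off_porous_set (1 / Suc n) f Z" for n using P[of "Suc (2 * n)"] by (simp add: P_def)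
    then obtain Z where flat: "\<And>n. flat_off_porous_set (1 / Suc n) f (Z n)" by metis
    \<comment> \<open>Points of \<open>E\<close> lie in all but finitely many \<open>Z n\<close>;
      sorting them by the index from which this holds gives the countable decomposition.\<close>
    define S where "S = (\<lambda>N. E \<inter> (\<Inter>n\<in>{N..}. Z n))"
    have S: "S N \<subseteq> Z n" if "n \<ge> N" for n N using that by (auto simp: S_def)
    have E_eq: "E = (\<Union>N. S N)"
      using E(2) positive_little_lip_imp_eventually_mem[OF flat] unfolding S_def by fastforce
    have "strongly_porous (S N)" for N
      by (rule strongly_porous_if_eventually_flat[OF flat S])
    then have porous: "sigma_strongly_porous E"
      unfolding sigma_strongly_porous_def using E_eq by (intro exI[of _ "range S"]) auto
    have "lower_packing_dim E \<le> ennreal (real (CARD('d) - 1))"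
      using E_eq lower_packing_premeasure_eq_0_if_eventually_flat[OF flat S]
      by (intro lower_packing_dim_le[of E S]) auto
    then have upper: "lower_packing_dim E \<le> of_nat (CARD('d) - 1)"
      by (simp add: ennreal_of_nat_eq_real_of_nat)
    have lower: "of_nat (CARD('d) - 1) \<le> hausdorff_dim E"
    \<comment> \<open>In dimension one the lower bound is 0.\<close>
    proof (cases "CARD('d) \<ge> 2")
      case True
      then show ?thesis
      proof (rule hausdorff_dim_ge_if_meets_lines)
        fix p :: "real ^ 'd" assume "p \<in> cbox 0 1"
        from infinite_little_lip_on_line[OF cont steep this]
        show "\<exists>x\<in>E. \<forall>i. i \<noteq> k \<longrightarrow> x $ i = p $ i" using E(1) by blast
      qed
    qed simp
    show ?thesis
      using porous upper lower hausdorff_dim_le_lower_packing_dim[of E] by (auto intro: antisym order_trans)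
  qed
  have "\<forall>E\<in>{{x \<in> cbox 0 1. little_lip (cbox 0 1) f x > 0},
      {x \<in> cbox 0 1. little_lip (cbox 0 1) f x = \<infinity>}}.
      sigma_strongly_porous E \<and> lower_packing_dim E = of_nat (CARD('d) - 1) \<and>
      hausdorff_dim E = of_nat (CARD('d) - 1)" if "f \<in> \<F>" for f
    by (intro ballI dims[OF that]) auto
  with comeager show ?thesis by blast
qed

end
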